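(* Let $A,C\in\mathcal{B}(\mathcal{H})$ be commuting operators on a complex Hilbert space $\mathcal{H}$ such that $A$ is positive and invertible, $\|C\|\le1$, and $I+A(A-2I)C^*C$ is invertible. Put $$B=(I+A(A-2I)C^*C)^{-1/2},\quad B_*=(I+A(A-2I)CC^* )^{-1/2},\quad D=(I-C^*C)^{1/2},\quad D_*=(I-CC^* )^{1/2},\quad T=ABDC.$$ Let $\mathcal{K}=\ell^2(\mathcal{H})\oplus\mathcal{H}^{\oplus3}\oplus\ell^2(\mathcal{H})$, viewed as $\bigoplus_{n\in\mathbb{Z}}\mathcal{H}$ with $\mathcal{H}$ identified with the $0$-th summand, and let $U=[U_{ij}]_{i,j\in\mathbb{Z}}$ be the operator on $\mathcal{K}$ whose blocks in rows $0,1,2$ and columns $-1,0,1$ are $$\begin{bmatrix} U_{0,-1} & U_{00} & U_{01} \\ {U_{1,-1}} & U_{10} & U_{11} \\ {U_{2,-1}} & U_{20} & U_{21} \end{bmatrix}=\begin{bmatrix} -(A-I)BC^* & BDC & BDD_* \\ {B_*D_*} & (A-I)CBC & (A-I)CBD_* \\ 0 & D & -C^* \end{bmatrix},$$ with $U_{j+1,j}=I$ for all $j\le-2$ and all $j\ge2$, and all other blocks equal to $0$. Then $U$ is a unitary dilation of the sequence $\{T_n\}_{n\ge0}$ given by $T_0=I$ and $T_n=A^{-1/2}T^nA^{-1/2}=A^{n-1}(BDC)^n$ for $n\ge1$; that is, $U$ is unitary and $T_n=P_{\mathcal{H}}U^n|_{\mathcal{H}}$ for all $n\ge0$.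
   Context: $\ell^2(\mathcal{H})$ is the Hilbert space of square-summable sequences in $\mathcal{H}$; $U_{ij}$ denotes the block from the $j$-th to the $i$-th summand, and $P_{\mathcal{H}}$ is the orthogonal projection of $\mathcal{K}$ onto the $0$-th summand. Under the stated hypotheses $I+A(A-2I)C^*C$ and $I+A(A-2I)CC^*$ are positive and invertible, so $B$ and $B_*$ are well defined. *)

theory Defs
  imports "HOL-Analysis.Analysis"
begin

section \<open>Complex Hilbert spaces\<close>

text \<open>The inner product is linear in the first argument. Positive definiteness and the relation
  between norm and inner product come from \<^class>\<open>real_inner\<close>, whose real inner product is the
  real part of the complex one.\<close>

class complex_hilbert = real_inner + complete_space +
  fixes scaleC :: "complex \<Rightarrow> 'a \<Rightarrow> 'a"  (infixr \<open>*\<^sub>C\<close> 75)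
    and cinner :: "'a \<Rightarrow> 'a \<Rightarrow> complex"
  assumes scaleC_add_right: "c *\<^sub>C (x + y) = c *\<^sub>C x + c *\<^sub>C y"
    and scaleC_add_left: "(c + d) *\<^sub>C x = c *\<^sub>C x + d *\<^sub>C x"
    and scaleC_scaleC: "c *\<^sub>C d *\<^sub>C x = (c * d) *\<^sub>C x"
    and scaleR_eq_scaleC: "r *\<^sub>R x = complex_of_real r *\<^sub>C x"
    and cinner_commute: "cinner x y = cnj (cinner y x)"
    and cinner_add_left: "cinner (x + y) z = cinner x z + cinner y z"
    and cinner_scaleC_left: "cinner (c *\<^sub>C x) y = c * cinner x y"
    and inner_eq_Re_cinner: "inner x y = Re (cinner x y)"

lemma cinner_self: "cinner x x = complex_of_real ((norm x)\<^sup>2)"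
proof -
  have "Im (cinner x x) = 0"
    using cinner_commute[of x x] by (simp add: complex_eq_iff)
  then show ?thesis
    by (simp add: complex_eq_iff power2_norm_eq_inner inner_eq_Re_cinner)
qed

lemma norm_scaleC: "norm (c *\<^sub>C x) = cmod c * norm (x :: 'a::complex_hilbert)"
proof -
  have "cinner (c *\<^sub>C x) (c *\<^sub>C x) = c * cnj c * cinner x x"
    by (metis cinner_commute cinner_scaleC_left complex_cnj_mult mult.assoc)
  then have "(norm (c *\<^sub>C x))\<^sup>2 = (cmod c * norm x)\<^sup>2"
    unfolding cinner_self complex_norm_square[symmetric]
    by (simp only: power_mult_distrib of_real_eq_iff flip: of_real_mult)
  then show ?thesis
    by (metis norm_ge_zero mult_nonneg_nonneg power2_eq_iff_nonneg)
qed

lemma cmod_cinner_le: "cmod (cinner x y) \<le> norm x * norm y"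
proof (cases "cinner x y = 0")
  case False
  define u where "u = cnj (cinner x y) / complex_of_real (cmod (cinner x y))"
  have "cmod u = 1"
    using False by (simp add: u_def norm_divide)
  have "cinner (u *\<^sub>C x) y = complex_of_real (cmod (cinner x y))"
    using False by (simp add: u_def cinner_scaleC_left mult.commute[of "cnj _"]
        power2_eq_square flip: complex_norm_square)
  then have "cmod (cinner x y) = inner (u *\<^sub>C x) y"
    by (simp add: inner_eq_Re_cinner)
  also have "\<dots> \<le> norm (u *\<^sub>C x) * norm y"
    by (rule norm_cauchy_schwarz)
  finally show ?thesis
    by (simp add: norm_scaleC \<open>cmod u = 1\<close>)
qed simp

lemma scaleC_zero_right: "c *\<^sub>C (0 :: 'a::complex_hilbert) = 0"
  using scaleC_add_right[of c "0::'a" 0] by simp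

lemma scaleC_minus_right: "c *\<^sub>C (- x) = - (c *\<^sub>C (x :: 'a::complex_hilbert))"
  using scaleC_add_right[of c x "- x"] by (simp add: scaleC_zero_right eq_neg_iff_add_eq_0 add.commute)

lemma scaleC_diff_right: "c *\<^sub>C (x - y) = c *\<^sub>C x - c *\<^sub>C (y :: 'a::complex_hilbert)"
  using scaleC_add_right[of c x "- y"] by (simp add: scaleC_minus_right)

lemma scaleC_scaleR_commute: "c *\<^sub>C (r *\<^sub>R x) = r *\<^sub>R (c *\<^sub>C (x :: 'a::complex_hilbert))"
  by (simp add: scaleR_eq_scaleC scaleC_scaleC mult.commute)


section \<open>The algebra of bounded operators\<close>

typedef (overloaded) 'a bop =
  "{f :: 'a::complex_hilbert \<Rightarrow> 'a. bounded_linear f \<and> (\<forall>c x. f (c *\<^sub>C x) = c *\<^sub>C f x)}"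
  morphisms bop_apply Bop
  by (rule exI[of _ "\<lambda>x. x"]) simp

declare [[coercion "bop_apply :: 'a::complex_hilbert bop \<Rightarrow> 'a \<Rightarrow> 'a"]]

setup_lifting type_definition_bop

instantiation bop :: (complex_hilbert) real_normed_algebra
begin

lift_definition norm_bop :: "'a bop \<Rightarrow> real" is onorm .

lift_definition zero_bop :: "'a bop" is "\<lambda>x. 0"
  by (simp add: scaleC_zero_right)

lift_definition plus_bop :: "'a bop \<Rightarrow> 'a bop \<Rightarrow> 'a bop" is "\<lambda>f g x. f x + g x"
  by (simp add: bounded_linear_add scaleC_add_right)

lift_definition uminus_bop :: "'a bop \<Rightarrow> 'a bop" is "\<lambda>f x. - f x"
  by (simp add: bounded_linear_minus scaleC_minus_right)

lift_definition minus_bop :: "'a bop \<Rightarrow> 'a bop \<Rightarrow> 'a bop" is "\<lambda>f g x. f x - g x"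
  by (simp add: bounded_linear_sub scaleC_diff_right)

lift_definition scaleR_bop :: "real \<Rightarrow> 'a bop \<Rightarrow> 'a bop" is "\<lambda>r f x. r *\<^sub>R f x"
  by (simp add: bounded_linear_const_scaleR scaleC_scaleR_commute)

lift_definition times_bop :: "'a bop \<Rightarrow> 'a bop \<Rightarrow> 'a bop" is "\<lambda>f g x. f (g x)"
  by (simp add: bounded_linear_compose)

definition sgn_bop :: "'a bop \<Rightarrow> 'a bop"
  where "sgn_bop X = inverse (norm X) *\<^sub>R X"

definition dist_bop :: "'a bop \<Rightarrow> 'a bop \<Rightarrow> real"
  where "dist_bop X Y = norm (X - Y)"

definition uniformity_bop :: "('a bop \<times> 'a bop) filter"
  where "uniformity_bop = (INF e\<in>{0<..}. principal {(X, Y). dist X Y < e})"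

definition open_bop :: "'a bop set \<Rightarrow> bool"
  where "open_bop S \<longleftrightarrow> (\<forall>X\<in>S. \<forall>\<^sub>F (Y, Z) in uniformity. Y = X \<longrightarrow> Z \<in> S)"

instance
proof
  fix X Y Z :: "'a bop" and r s :: real
  show "dist X Y = norm (X - Y)" by (fact dist_bop_def)
  show "sgn X = inverse (norm X) *\<^sub>R X" by (fact sgn_bop_def)
  show "uniformity = (INF e\<in>{0<..}. principal {(X :: 'a bop, Y). dist X Y < e})"
    by (fact uniformity_bop_def)
  show "open S \<longleftrightarrow> (\<forall>X\<in>S. \<forall>\<^sub>F (Y, Z) in uniformity. Y = X \<longrightarrow> Z \<in> S)" for S :: "'a bop set"
    by (fact open_bop_def)
  show "X + Y + Z = X + (Y + Z)" by transfer (simp add: add.assoc)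
  show "X + Y = Y + X" by transfer (simp add: add.commute)
  show "0 + X = X" by transfer simp
  show "- X + X = 0" by transfer simp
  show "X - Y = X + - Y" by transfer simp
  show "r *\<^sub>R (X + Y) = r *\<^sub>R X + r *\<^sub>R Y" by transfer (simp add: scaleR_add_right)
  show "(r + s) *\<^sub>R X = r *\<^sub>R X + s *\<^sub>R X" by transfer (simp add: scaleR_add_left)
  show "r *\<^sub>R s *\<^sub>R X = (r * s) *\<^sub>R X" by transfer simp
  show "1 *\<^sub>R X = X" by transfer simp
  show "X * Y * Z = X * (Y * Z)" by transfer simp
  show "(X + Y) * Z = X * Z + Y * Z" by transfer simp
  show "X * (Y + Z) = X * Y + X * Z"
    by transfer (simp add: bounded_linear.linear linear_add)
  show "r *\<^sub>R X * Y = r *\<^sub>R (X * Y)" by transfer simp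
  show "X * r *\<^sub>R Y = r *\<^sub>R (X * Y)"
    by transfer (simp add: bounded_linear.linear linear_scale)
  show "norm X = 0 \<longleftrightarrow> X = 0" by transfer (auto simp: onorm_eq_0)
  show "norm (X + Y) \<le> norm X + norm Y" by transfer (simp add: onorm_triangle)
  show "norm (r *\<^sub>R X) = \<bar>r\<bar> * norm X" by transfer (simp add: onorm_scaleR)
  show "norm (X * Y) \<le> norm X * norm Y"
    by transfer (use onorm_compose in \<open>force simp: o_def\<close>)
qed

end

instantiation bop :: (complex_hilbert) monoid_mult
begin

lift_definition one_bop :: "'a bop" is "\<lambda>x. x"
  by simp

instance
  by standard (transfer, simp)+

end

definition adj :: "'a::complex_hilbert bop \<Rightarrow> 'a bop"
  where "adj X = (THE Y :: 'a bop. \<forall>x y. cinner (X x) y = cinner x (Y y))"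

definition positive_op :: "'a::complex_hilbert bop \<Rightarrow> bool"
  where "positive_op X \<longleftrightarrow> (\<forall>x. cinner (X x) x \<in> \<real>\<^sub>\<ge>\<^sub>0)"

definition invertible_op :: "'a::complex_hilbert bop \<Rightarrow> bool"
  where "invertible_op X \<longleftrightarrow> (\<exists>Y. X * Y = 1 \<and> Y * X = 1)"

definition inv_op :: "'a::complex_hilbert bop \<Rightarrow> 'a bop"
  where "inv_op X = (THE Y. X * Y = 1 \<and> Y * X = 1)"

definition sqrt_op :: "'a::complex_hilbert bop \<Rightarrow> 'a bop"
  where "sqrt_op X = (THE S. positive_op S \<and> S * S = X)"

definition unitary_op :: "'a::complex_hilbert bop \<Rightarrow> bool"
  where "unitary_op U \<longleftrightarrow> adj U * U = 1 \<and> U * adj U = 1"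

definition orth_proj :: "'a::complex_hilbert set \<Rightarrow> 'a \<Rightarrow> 'a"
  where "orth_proj M x = (THE y. y \<in> M \<and> (\<forall>z\<in>M. cinner (x - y) z = 0))"


section \<open>The Hilbert space of square-summable two-sided sequences\<close>

typedef (overloaded) 'a ell2Z =
  "{f :: int \<Rightarrow> 'a::complex_hilbert. (\<lambda>n. (norm (f n))\<^sup>2) summable_on UNIV}"
  morphisms coord Ell2Z
  by (rule exI[of _ "\<lambda>_. 0"]) simp

setup_lifting type_definition_ell2Z

lemma sq_norm_add_le: "(norm (x + y))\<^sup>2 \<le> 2 * (norm x)\<^sup>2 + 2 * (norm (y :: 'a::real_inner))\<^sup>2"
  using inner_ge_zero[of "x - y"]
  by (simp add: power2_norm_eq_inner inner_add inner_diff inner_commute)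

lemma square_summable_add:
  fixes f g :: "int \<Rightarrow> 'a::real_inner"
  assumes "(\<lambda>n. (norm (f n))\<^sup>2) summable_on UNIV" "(\<lambda>n. (norm (g n))\<^sup>2) summable_on UNIV"
  shows "(\<lambda>n. (norm (f n + g n))\<^sup>2) summable_on UNIV"
  by (rule summable_on_comparison_test
      [OF summable_on_add[OF summable_on_cmult_right summable_on_cmult_right, OF assms]])
    (auto intro: sq_norm_add_le)

lemma summable_cinner:
  fixes f g :: "int \<Rightarrow> 'a::complex_hilbert"
  assumes "(\<lambda>n. (norm (f n))\<^sup>2) summable_on UNIV" "(\<lambda>n. (norm (g n))\<^sup>2) summable_on UNIV"
  shows "(\<lambda>n. cinner (f n) (g n)) summable_on UNIV"
proof (rule abs_summable_summable, rule Infinite_Sum.abs_summable_on_comparison_test'[OF summable_on_add[OF assms]])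
  fix n
  have "2 * (norm (f n) * norm (g n)) \<le> (norm (f n))\<^sup>2 + (norm (g n))\<^sup>2"
    using sum_squares_bound[of "norm (f n)" "norm (g n)"] by (simp add: mult.assoc)
  moreover have "0 \<le> norm (f n) * norm (g n)"
    by simp
  ultimately show "norm (cinner (f n) (g n)) \<le> (norm (f n))\<^sup>2 + (norm (g n))\<^sup>2"
    using cmod_cinner_le[of "f n" "g n"] by linarith
qed

instantiation ell2Z :: (complex_hilbert) real_inner
begin

lift_definition zero_ell2Z :: "'a ell2Z" is "\<lambda>_. 0"
  by simp

lift_definition plus_ell2Z :: "'a ell2Z \<Rightarrow> 'a ell2Z \<Rightarrow> 'a ell2Z" is "\<lambda>f g n. f n + g n"
  by (rule square_summable_add)

lift_definition uminus_ell2Z :: "'a ell2Z \<Rightarrow> 'a ell2Z" is "\<lambda>f n. - f n"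
  by simp

lift_definition minus_ell2Z :: "'a ell2Z \<Rightarrow> 'a ell2Z \<Rightarrow> 'a ell2Z" is "\<lambda>f g n. f n - g n"
  using square_summable_add[of _ "\<lambda>n. - _ n"] by fastforce

lift_definition scaleR_ell2Z :: "real \<Rightarrow> 'a ell2Z \<Rightarrow> 'a ell2Z" is "\<lambda>r f n. r *\<^sub>R f n"
  by (simp add: power_mult_distrib summable_on_cmult_right)

definition inner_ell2Z :: "'a ell2Z \<Rightarrow> 'a ell2Z \<Rightarrow> real"
  where "inner_ell2Z x y = Re (\<Sum>\<^sub>\<infinity>n. cinner (coord x n) (coord y n))"

definition norm_ell2Z :: "'a ell2Z \<Rightarrow> real"
  where "norm_ell2Z x = sqrt (inner x x)"

definition sgn_ell2Z :: "'a ell2Z \<Rightarrow> 'a ell2Z"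
  where "sgn_ell2Z x = inverse (norm x) *\<^sub>R x"

definition dist_ell2Z :: "'a ell2Z \<Rightarrow> 'a ell2Z \<Rightarrow> real"
  where "dist_ell2Z x y = norm (x - y)"

definition uniformity_ell2Z :: "('a ell2Z \<times> 'a ell2Z) filter"
  where "uniformity_ell2Z = (INF e\<in>{0<..}. principal {(x, y). dist x y < e})"

definition open_ell2Z :: "'a ell2Z set \<Rightarrow> bool"
  where "open_ell2Z S \<longleftrightarrow> (\<forall>x\<in>S. \<forall>\<^sub>F (y, z) in uniformity. y = x \<longrightarrow> z \<in> S)"

lemma summable_coord: "(\<lambda>n. (norm (coord x n))\<^sup>2) summable_on UNIV"
  using coord[of x] by simp

lemma summable_cinner_coord: "(\<lambda>n. cinner (coord x n) (coord y n)) summable_on UNIV"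
  by (rule summable_cinner) (rule summable_coord)+

lemma inner_ell2Z_self: "inner x x = (\<Sum>\<^sub>\<infinity>n. (norm (coord x n))\<^sup>2)" for x :: "'a ell2Z"
proof -
  have "(\<Sum>\<^sub>\<infinity>n. cinner (coord x n) (coord x n)) = complex_of_real (\<Sum>\<^sub>\<infinity>n. (norm (coord x n))\<^sup>2)"
    unfolding cinner_self
    by (rule infsumI, rule has_sum_of_real) (rule has_sum_infsum[OF summable_coord])
  then show ?thesis
    by (simp add: inner_ell2Z_def)
qed

instance
proof
  fix x y z :: "'a ell2Z" and r s :: real
  show "dist x y = norm (x - y)" by (fact dist_ell2Z_def)
  show "sgn x = inverse (norm x) *\<^sub>R x" by (fact sgn_ell2Z_def)
  show "uniformity = (INF e\<in>{0<..}. principal {(x :: 'a ell2Z, y). dist x y < e})"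
    by (fact uniformity_ell2Z_def)
  show "open S \<longleftrightarrow> (\<forall>x\<in>S. \<forall>\<^sub>F (y, z) in uniformity. y = x \<longrightarrow> z \<in> S)" for S :: "'a ell2Z set"
    by (fact open_ell2Z_def)
  show "norm x = sqrt (inner x x)" by (fact norm_ell2Z_def)
  show "x + y + z = x + (y + z)" by transfer (simp add: add.assoc)
  show "x + y = y + x" by transfer (simp add: add.commute)
  show "0 + x = x" by transfer simp
  show "- x + x = 0" by transfer simp
  show "x - y = x + - y" by transfer simp
  show "r *\<^sub>R (x + y) = r *\<^sub>R x + r *\<^sub>R y" by transfer (simp add: scaleR_add_right)
  show "(r + s) *\<^sub>R x = r *\<^sub>R x + s *\<^sub>R x" by transfer (simp add: scaleR_add_left)
  show "r *\<^sub>R s *\<^sub>R x = (r * s) *\<^sub>R x" by transfer simp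
  show "1 *\<^sub>R x = x" by transfer simp
  have "(\<Sum>\<^sub>\<infinity>n. cinner (coord x n) (coord y n)) = cnj (\<Sum>\<^sub>\<infinity>n. cinner (coord y n) (coord x n))"
    using infsum_cnj[of "\<lambda>n. cinner (coord y n) (coord x n)" UNIV]
    by (simp flip: cinner_commute)
  then show "inner x y = inner y x"
    by (simp add: inner_ell2Z_def)
  show "inner (x + y) z = inner x z + inner y z"
    by (simp add: inner_ell2Z_def plus_ell2Z.rep_eq cinner_add_left infsum_add summable_cinner_coord)
  show "inner (r *\<^sub>R x) y = r * inner x y"
    by (simp add: inner_ell2Z_def scaleR_ell2Z.rep_eq scaleR_eq_scaleC cinner_scaleC_left
        infsum_cmult_right')
  show "0 \<le> inner x x"
    unfolding inner_ell2Z_self by (rule infsum_nonneg) simp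
  show "inner x x = 0 \<longleftrightarrow> x = 0"
  proof
    assume "inner x x = 0"
    then have "(norm (coord x n))\<^sup>2 = 0" for n
      unfolding inner_ell2Z_self using nonneg_infsum_le_0D[OF _ summable_coord] by force
    then show "x = 0"
      by transfer auto
  qed (simp add: inner_ell2Z_self zero_ell2Z.rep_eq)
qed

end

lemma norm_ell2Z_sq: "(norm x)\<^sup>2 = (\<Sum>\<^sub>\<infinity>n. (norm (coord x n))\<^sup>2)"
  by (simp add: power2_norm_eq_inner inner_ell2Z_self)

lemma sum_coord_le: "finite F \<Longrightarrow> (\<Sum>n\<in>F. (norm (coord x n))\<^sup>2) \<le> (norm x)\<^sup>2"
  unfolding norm_ell2Z_sq by (rule finite_sum_le_infsum[OF summable_coord]) auto

lemma norm_coord_le: "norm (coord x n) \<le> norm x"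
  using sum_coord_le[of "{n}" x] by (simp add: power2_le_iff_abs_le)

instance ell2Z :: (complex_hilbert) complete_space
proof
  fix X :: "nat \<Rightarrow> 'a ell2Z"
  assume X: "Cauchy X"
  have "Cauchy (\<lambda>m. coord (X m) n)" for n
  proof (rule metric_CauchyI)
    fix e :: real assume "e > 0"
    then obtain N where "\<forall>m\<ge>N. \<forall>k\<ge>N. dist (X m) (X k) < e"
      using X by (blast dest: metric_CauchyD)
    moreover have "dist (coord x n) (coord y n) \<le> dist x y" for x y :: "'a ell2Z"
      using norm_coord_le[of "x - y" n] by (simp add: dist_norm minus_ell2Z.rep_eq)
    ultimately show "\<exists>N. \<forall>m\<ge>N. \<forall>k\<ge>N. dist (coord (X m) n) (coord (X k) n) < e"
      by (blast intro: order_le_less_trans)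
  qed
  then have "\<forall>n. \<exists>l. (\<lambda>m. coord (X m) n) \<longlonglongrightarrow> l"
    by (simp add: Cauchy_convergent flip: convergent_def)
  then obtain L where L: "\<And>n. (\<lambda>m. coord (X m) n) \<longlonglongrightarrow> L n"
    by metis
  have tail: "\<exists>N. \<forall>m\<ge>N. \<forall>F. finite F \<longrightarrow> (\<Sum>n\<in>F. (norm (coord (X m) n - L n))\<^sup>2) \<le> e\<^sup>2"
    if e: "e > 0" for e :: real
  proof -
    obtain N where N: "\<forall>m\<ge>N. \<forall>k\<ge>N. dist (X m) (X k) < e"
      using X e by (blast dest: metric_CauchyD)
    have "(\<Sum>n\<in>F. (norm (coord (X m) n - L n))\<^sup>2) \<le> e\<^sup>2" if "m \<ge> N" "finite F" for m F
    proof (rule LIMSEQ_le_const2)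
      show "(\<lambda>k. \<Sum>n\<in>F. (norm (coord (X m) n - coord (X k) n))\<^sup>2)
          \<longlonglongrightarrow> (\<Sum>n\<in>F. (norm (coord (X m) n - L n))\<^sup>2)"
        by (intro tendsto_intros L)
      have "(\<Sum>n\<in>F. (norm (coord (X m) n - coord (X k) n))\<^sup>2) \<le> e\<^sup>2" if "k \<ge> N" for k
      proof -
        have "(\<Sum>n\<in>F. (norm (coord (X m) n - coord (X k) n))\<^sup>2) \<le> (norm (X m - X k))\<^sup>2"
          using sum_coord_le[OF \<open>finite F\<close>, of "X m - X k"] by (simp add: minus_ell2Z.rep_eq)
        also have "\<dots> \<le> e\<^sup>2"
          using N \<open>m \<ge> N\<close> \<open>k \<ge> N\<close> by (intro power_mono) (auto simp: dist_norm less_imp_le)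
        finally show ?thesis .
      qed
      then show "\<exists>N. \<forall>k\<ge>N. (\<Sum>n\<in>F. (norm (coord (X m) n - coord (X k) n))\<^sup>2) \<le> e\<^sup>2"
        by blast
    qed
    then show ?thesis
      by blast
  qed
  have summable: "(\<lambda>n. (norm (coord (X m) n - L n))\<^sup>2) summable_on UNIV"
    if "\<forall>F. finite F \<longrightarrow> (\<Sum>n\<in>F. (norm (coord (X m) n - L n))\<^sup>2) \<le> e" for m e
    using that by (intro nonneg_bdd_above_summable_on bdd_aboveI[of _ e]) auto
  obtain M where "\<forall>F. finite F \<longrightarrow> (\<Sum>n\<in>F. (norm (coord (X M) n - L n))\<^sup>2) \<le> 1\<^sup>2"
    using tail[of 1] by auto
  then have "(\<lambda>n. (norm (L n - coord (X M) n))\<^sup>2) summable_on UNIV"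
    using summable[of M] by (simp add: norm_minus_commute)
  from square_summable_add[OF this summable_coord[of "X M"]]
  have "(\<lambda>n. (norm (L n))\<^sup>2) summable_on UNIV"
    by simp
  then obtain l where l: "coord l = L"
    using Ell2Z_inverse by blast
  have "X \<longlonglongrightarrow> l"
  proof (rule metric_LIMSEQ_I)
    fix e :: real assume "e > 0"
    then obtain N where
      N: "\<forall>m\<ge>N. \<forall>F. finite F \<longrightarrow> (\<Sum>n\<in>F. (norm (coord (X m) n - L n))\<^sup>2) \<le> (e/2)\<^sup>2"
      using tail[of "e/2"] by auto
    have "dist (X m) l < e" if "m \<ge> N" for m
    proof -
      have "(norm (X m - l))\<^sup>2 \<le> (e/2)\<^sup>2"
        unfolding norm_ell2Z_sq minus_ell2Z.rep_eq l
        using N that by (intro infsum_le_finite_sums summable[of m "(e/2)\<^sup>2"]) auto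
      then have "norm (X m - l) \<le> e/2"
        using \<open>e > 0\<close> by (simp add: power2_le_iff_abs_le)
      then show ?thesis
        using \<open>e > 0\<close> by (simp add: dist_norm)
    qed
    then show "\<exists>N. \<forall>m\<ge>N. dist (X m) l < e"
      by blast
  qed
  then show "convergent X"
    by (auto simp: convergent_def)
qed

instantiation ell2Z :: (complex_hilbert) complex_hilbert
begin

lift_definition scaleC_ell2Z :: "complex \<Rightarrow> 'a ell2Z \<Rightarrow> 'a ell2Z" is "\<lambda>c f n. c *\<^sub>C f n"
  by (simp add: norm_scaleC power_mult_distrib summable_on_cmult_right)

definition cinner_ell2Z :: "'a ell2Z \<Rightarrow> 'a ell2Z \<Rightarrow> complex"
  where "cinner_ell2Z x y = (\<Sum>\<^sub>\<infinity>n. cinner (coord x n) (coord y n))"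

instance
proof
  fix x y z :: "'a ell2Z" and c d :: complex and r :: real
  show "c *\<^sub>C (x + y) = c *\<^sub>C x + c *\<^sub>C y" by transfer (simp add: scaleC_add_right)
  show "(c + d) *\<^sub>C x = c *\<^sub>C x + d *\<^sub>C x" by transfer (simp add: scaleC_add_left)
  show "c *\<^sub>C d *\<^sub>C x = (c * d) *\<^sub>C x" by transfer (simp add: scaleC_scaleC)
  show "r *\<^sub>R x = complex_of_real r *\<^sub>C x" by transfer (simp add: scaleR_eq_scaleC)
  show "cinner x y = cnj (cinner y x)"
    using infsum_cnj[of "\<lambda>n. cinner (coord y n) (coord x n)" UNIV]
    by (simp add: cinner_ell2Z_def flip: cinner_commute)
  show "cinner (x + y) z = cinner x z + cinner y z"
    by (simp add: cinner_ell2Z_def plus_ell2Z.rep_eq cinner_add_left infsum_add summable_cinner_coord)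
  show "cinner (c *\<^sub>C x) y = c * cinner x y"
    by (simp add: cinner_ell2Z_def scaleC_ell2Z.rep_eq cinner_scaleC_left infsum_cmult_right')
  show "inner x y = Re (cinner x y)"
    by (simp add: cinner_ell2Z_def inner_ell2Z_def)
qed

end

lift_definition emb :: "int \<Rightarrow> 'a::complex_hilbert \<Rightarrow> 'a ell2Z" is "\<lambda>j x n. if n = j then x else 0"
  by (rule summable_on_cong_neutral[THEN iffD1, OF _ _ _ summable_on_finite[of "{_}"]]) auto

lemma norm_emb: "norm (emb j x) = norm x"
proof -
  have "(norm (emb j x))\<^sup>2 = (\<Sum>\<^sub>\<infinity>n\<in>{j}. (norm x)\<^sup>2)"
    unfolding norm_ell2Z_sq emb.rep_eq by (rule infsum_cong_neutral) auto
  then show ?thesis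
    by simp
qed

lemma bounded_linear_emb: "bounded_linear (emb j)"
  by (rule bounded_linear_intro[where K = 1]; (transfer; auto)?) (simp add: norm_emb)

lemma bounded_linear_coord: "bounded_linear (\<lambda>x. coord x i)"
  by (rule bounded_linear_intro[where K = 1])
    (auto simp: plus_ell2Z.rep_eq scaleR_ell2Z.rep_eq norm_coord_le)

lemma emb_scaleC: "emb j (c *\<^sub>C x) = c *\<^sub>C emb j x"
  by transfer (auto simp: scaleC_zero_right)

text \<open>The block of \<open>U\<close> from the \<open>j\<close>-th to the \<open>i\<close>-th summand.\<close>

lift_definition block :: "'a::complex_hilbert ell2Z bop \<Rightarrow> int \<Rightarrow> int \<Rightarrow> 'a bop"
  is "\<lambda>U i j x. coord (U (emb j x)) i"
  by (simp add: emb_scaleC scaleC_ell2Z.rep_eq bounded_linear_compose[OF bounded_linear_coord]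
      bounded_linear_compose[OF _ bounded_linear_emb])

definition op_of_blocks :: "(int \<Rightarrow> int \<Rightarrow> 'a::complex_hilbert bop) \<Rightarrow> 'a ell2Z bop"
  where "op_of_blocks M = (THE U. \<forall>i j. block U i j = M i j)"

definition unitary_dilation :: "'a::complex_hilbert ell2Z bop \<Rightarrow> (nat \<Rightarrow> 'a bop) \<Rightarrow> bool"
  where "unitary_dilation U S \<longleftrightarrow>
    unitary_op U \<and> (\<forall>n x. orth_proj (range (emb 0)) ((U ^ n) (emb 0 x)) = emb 0 (S n x))"

end

theory Submission
  imports Defs
begin

text \<open>
  With \<open>E = A - I\<close>, the nontrivial \<open>3 \<times> 3\<close> part of \<open>U\<close> is the product of two \<open>2 \<times> 2\<close> block matrices
  padded by identities: the Julia operator with rows \<open>(C, D\<^sub>*)\<close>, \<open>(D, -C\<^sup>*)\<close>, and the matrix with rows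
  \<open>(-E B C\<^sup>*, B D)\<close>, \<open>(B\<^sub>* D\<^sub>*, E C B)\<close>. The first is unitary because \<open>C D = D\<^sub>* C\<close>, the second because
  \<open>B\<^sup>2 (D\<^sup>2 + E\<^sup>2 C\<^sup>* C) = I\<close>, the analogous identity for \<open>B\<^sub>*\<close>, and \<open>C B = B\<^sub>* C\<close>. Composing with the
  bilateral shift gives \<open>U\<close>. Along the orbit of a vector of the \<open>0\<close>-th summand, the combination
  \<open>w = C v\<^sub>0 + D\<^sub>* v\<^sub>1\<close> of the components in the summands \<open>0\<close> and \<open>1\<close> is multiplied by \<open>A C B D\<close> in each
  step, and the next \<open>0\<close>-th component is \<open>B D w\<close>.
\<close>

section \<open>Riesz representation and adjoints\<close>

text \<open>The representing vector minimises \<open>\<parallel>x\<parallel>\<^sup>2 - 2 \<phi> x\<close>; the parallelogram law makes minimising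
  sequences Cauchy.\<close>

lemma riesz_real:
  fixes \<phi> :: "'a::{real_inner, complete_space} \<Rightarrow> real"
  assumes "bounded_linear \<phi>"
  shows "\<exists>z. \<forall>x. \<phi> x = inner x z"
proof -
  interpret \<phi>: bounded_linear \<phi> by fact
  define F where "F x = (norm x)\<^sup>2 - 2 * \<phi> x" for x
  obtain K where K: "\<And>x. \<phi> x \<le> norm x * K"
    using \<phi>.bounded by (metis abs_le_D1 real_norm_def)
  \<comment> \<open>Completing the square: F x >= (|x| - K)^2 - K^2.\<close>
  have F_ge: "- K\<^sup>2 \<le> F x" for x
    using K[of x] zero_le_power2[of "norm x - K"]
    by (simp add: F_def power2_diff)
  define d where "d = (INF x. F x)"
  have bdd: "bdd_below (range F)"
    using F_ge by (auto intro!: bdd_belowI)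
  have d_le: "d \<le> F x" for x
    unfolding d_def by (rule cINF_lower[OF bdd]) simp
  have "\<exists>x. F x < d + inverse (real (Suc n))" for n
    using cINF_less_iff[OF _ bdd, of "d + inverse (real (Suc n))"] unfolding d_def by auto
  then obtain X where X: "\<And>n. F (X n) < d + inverse (real (Suc n))"
    by metis
  have par: "(norm (x - y))\<^sup>2 \<le> 2 * (F x - d) + 2 * (F y - d)" for x y
  proof -
    have "(norm ((1/2) *\<^sub>R (x + y)))\<^sup>2 = (norm (x + y))\<^sup>2 / 4"
      by (simp add: power_mult_distrib power2_eq_square)
    moreover have "\<phi> ((1/2) *\<^sub>R (x + y)) = (\<phi> x + \<phi> y) / 2"
      by (simp add: \<phi>.add \<phi>.scaleR)
    moreover have "(norm (x - y))\<^sup>2 = 2 * (norm x)\<^sup>2 + 2 * (norm y)\<^sup>2 - (norm (x + y))\<^sup>2"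
      by (simp add: power2_norm_eq_inner inner_add inner_diff inner_commute)
    ultimately have "(norm (x - y))\<^sup>2 = 2 * F x + 2 * F y - 4 * F ((1/2) *\<^sub>R (x + y))"
      by (simp add: F_def del: norm_scaleR)
    then show ?thesis
      using d_le[of "(1/2) *\<^sub>R (x + y)"] by simp
  qed
  have "Cauchy X"
  proof (rule metric_CauchyI)
    fix e :: real assume e: "e > 0"
    obtain N where N: "inverse (real (Suc N)) < e\<^sup>2 / 4"
      using reals_Archimedean[of "e\<^sup>2 / 4"] e by auto
    have "dist (X m) (X n) < e" if "m \<ge> N" "n \<ge> N" for m n
    proof -
      have "F (X k) - d < e\<^sup>2 / 4" if "k \<ge> N" for k
      proof -
        have "inverse (real (Suc k)) \<le> inverse (real (Suc N))"
          using that by (intro le_imp_inverse_le) auto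
        then show ?thesis using X[of k] N by linarith
      qed
      from this[OF that(1)] this[OF that(2)]
      have "2 * (F (X m) - d) + 2 * (F (X n) - d) < 2 * (e\<^sup>2 / 4) + 2 * (e\<^sup>2 / 4)"
        by (intro add_strict_mono mult_strict_left_mono) auto
      also have "\<dots> = e\<^sup>2" by simp
      finally have "2 * (F (X m) - d) + 2 * (F (X n) - d) < e\<^sup>2" .
      with par[of "X m" "X n"] have "(norm (X m - X n))\<^sup>2 < e\<^sup>2"
        by (rule order_le_less_trans)
      then show ?thesis
        using e by (simp add: dist_norm power2_less_imp_less)
    qed
    then show "\<exists>N. \<forall>m\<ge>N. \<forall>n\<ge>N. dist (X m) (X n) < e" by blast
  qed
  then obtain z where z: "X \<longlonglongrightarrow> z"
    by (auto simp: Cauchy_convergent_iff convergent_def)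
  have lim: "(\<lambda>n. F (X n)) \<longlonglongrightarrow> F z"
    unfolding F_def by (intro tendsto_intros z \<phi>.tendsto)
  have "(\<lambda>n. d + inverse (real (Suc n))) \<longlonglongrightarrow> d + 0"
    by (intro tendsto_intros LIMSEQ_inverse_real_of_nat)
  from LIMSEQ_le[OF lim this] have Fz: "F z \<le> d"
    using X less_imp_le by auto
  have "\<phi> x = inner x z" for x
  proof -
    define b where "b = inner x z - \<phi> x"
    \<comment> \<open>First variation at the minimiser \<open>z\<close>. For nonzero x, the choice t
      = -b/|x|^2 minimises this quadratic and leaves -b^2/|x|^2 >= 0, forcing
      \<open>b = 0\<close>.\<close>
    have q: "0 \<le> t\<^sup>2 * (norm x)\<^sup>2 + 2 * t * b" for t
    proof -
      have "F (z + t *\<^sub>R x) = F z + t\<^sup>2 * (norm x)\<^sup>2 + 2 * t * b"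
        unfolding F_def b_def power2_norm_eq_inner
        by (simp add: \<phi>.add \<phi>.scaleR inner_add inner_commute power2_eq_square algebra_simps)
      then show ?thesis using d_le[of "z + t *\<^sub>R x"] Fz by linarith
    qed
    have "b = 0"
    proof (cases "x = 0")
      case True
      then show ?thesis by (simp add: b_def \<phi>.zero)
    next
      case False
      then have n: "(norm x)\<^sup>2 > 0" by simp
      define s where "s = (norm x)\<^sup>2"
      have "(- b / s)\<^sup>2 * s + 2 * (- b / s) * b = - (b\<^sup>2 / s)"
        using n unfolding s_def[symmetric] by (simp add: power2_eq_square field_simps)
      with q[of "- b / s"] have "0 \<le> - (b\<^sup>2 / (norm x)\<^sup>2)"
        by (simp add: s_def)
      then have "b\<^sup>2 / (norm x)\<^sup>2 \<le> 0" by simp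
      then show ?thesis using n by (simp add: divide_le_0_iff)
    qed
    then show ?thesis by (simp add: b_def)
  qed
  then show ?thesis by blast
qed

section \<open>Sesquilinear calculus and pointwise rules for bounded operators\<close>

lemma cinner_scaleC_right: "cinner x (c *\<^sub>C y) = cnj c * cinner x y"
  by (metis cinner_commute cinner_scaleC_left complex_cnj_mult)

lemma cinner_add_right: "cinner x (y + z) = cinner x y + cinner x z"
  by (metis cinner_commute cinner_add_left complex_cnj_add)

lemma cinner_zero_left [simp]: "cinner 0 x = 0"
  using cinner_add_left[of 0 0 x] by simp

lemma cinner_zero_right [simp]: "cinner x 0 = 0"
  using cinner_add_right[of x 0 0] by simp

lemma cinner_minus_left: "cinner (- x) y = - cinner x y"
  using cinner_add_left[of x "- x" y] by (simp add: eq_neg_iff_add_eq_0 add.commute)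

lemma cinner_minus_right: "cinner x (- y) = - cinner x y"
  using cinner_add_right[of x y "- y"] by (simp add: eq_neg_iff_add_eq_0 add.commute)

lemma cinner_diff_left: "cinner (x - y) z = cinner x z - cinner y z"
  using cinner_add_left[of x "- y" z] by (simp add: cinner_minus_left)

lemma cinner_diff_right: "cinner x (y - z) = cinner x y - cinner x z"
  using cinner_add_right[of x y "- z"] by (simp add: cinner_minus_right)

lemma cinner_eqI_right: "(\<And>x. cinner x y = cinner x z) \<Longrightarrow> y = z"
proof -
  assume "\<And>x. cinner x y = cinner x z"
  then have "cinner (y - z) (y - z) = 0"
    by (simp add: cinner_diff_right)
  then show "y = z" by (simp add: cinner_self)
qed

lemma cinner_eqI_left: "(\<And>x. cinner y x = cinner z x) \<Longrightarrow> y = z"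
  by (rule cinner_eqI_right) (metis cinner_commute)

lemma bop_bounded_linear: "bounded_linear (bop_apply X)"
  using bop_apply[of X] by simp

lemma bop_scaleC: "X (c *\<^sub>C x) = c *\<^sub>C X x" for X :: "'a::complex_hilbert bop"
  using bop_apply[of X] by simp

lemma bop_add: "X (x + y) = X x + X y" for X :: "'a::complex_hilbert bop"
  by (simp add: bop_bounded_linear linear_add bounded_linear.linear)

lemma bop_diff: "X (x - y) = X x - X y" for X :: "'a::complex_hilbert bop"
  by (simp add: bop_bounded_linear linear_diff bounded_linear.linear)

lemma bop_zero [simp]: "bop_apply X 0 = 0"
  by (simp add: bop_bounded_linear linear_0 bounded_linear.linear)

lemma bop_norm_le: "norm (X x) \<le> norm X * norm x" for X :: "'a::complex_hilbert bop"
  unfolding norm_bop.rep_eq by (rule onorm[OF bop_bounded_linear])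

lemma bop_eqI: "(\<And>x. X x = Y x) \<Longrightarrow> X = Y" for X Y :: "'a::complex_hilbert bop"
  by (simp add: bop_apply_inject[symmetric] fun_eq_iff)

lemmas bop_reps [simp] = zero_bop.rep_eq plus_bop.rep_eq uminus_bop.rep_eq minus_bop.rep_eq
  scaleR_bop.rep_eq times_bop.rep_eq one_bop.rep_eq

text \<open>Riesz for the real functional \<open>inner (X x) y\<close> of x fixes only real parts;
  replacing x by i x recovers the imaginary parts. The bound on \<open>g\<close> comes from |g y|^2
  = <X (g y), y> and Cauchy-Schwarz.\<close>

lemma adj_exists:
  fixes X :: "'a::complex_hilbert bop"
  shows "\<exists>Y :: 'a bop. \<forall>x y. cinner (X x) y = cinner x (Y y)"
proof -
  have "\<exists>z. \<forall>x. cinner (X x) y = cinner x z" for y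
  proof -
    have "bounded_linear (\<lambda>x. inner (X x) y)"
      by (rule bounded_linear_compose[OF bounded_linear_inner_left bop_bounded_linear])
    then obtain z where z: "\<And>x. inner (X x) y = inner x z"
      using riesz_real by blast
    have Re: "Re (cinner (X x) y) = Re (cinner x z)" for x
      using z[of x] by (simp add: inner_eq_Re_cinner)
    have "cinner (X x) y = cinner x z" for x
      using Re[of x] Re[of "\<i> *\<^sub>C x"]
      by (simp add: complex_eq_iff bop_scaleC cinner_scaleC_left)
    then show ?thesis by blast
  qed
  then obtain g where g: "\<And>x y. cinner (X x) y = cinner x (g y)"
    by metis
  have g_add: "g (x + y) = g x + g y" for x y
    by (rule cinner_eqI_right) (simp add: cinner_add_right flip: g)
  have g_scaleC: "g (c *\<^sub>C x) = c *\<^sub>C g x" for c x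
    by (rule cinner_eqI_right) (simp add: cinner_scaleC_right flip: g)
  have g_norm: "norm (g y) \<le> norm y * norm X" for y
  proof (cases "g y = 0")
    case False
    have "(norm (g y))\<^sup>2 = cmod (cinner (X (g y)) y)"
      by (simp add: g cinner_self norm_power)
    also have "\<dots> \<le> norm (X (g y)) * norm y"
      by (rule cmod_cinner_le)
    also have "\<dots> \<le> norm X * norm (g y) * norm y"
      by (intro mult_right_mono bop_norm_le) simp
    finally have "norm (g y) * norm (g y) \<le> norm (g y) * (norm y * norm X)"
      by (simp add: power2_eq_square mult_ac)
    then show ?thesis
      using False by (simp add: mult_le_cancel_left_pos)
  qed simp
  have "bounded_linear g"
    by (rule bounded_linear_intro[OF g_add _ g_norm]) (simp add: scaleR_eq_scaleC g_scaleC)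
  then have "bop_apply (Bop g) = g"
    by (intro Bop_inverse) (simp add: g_scaleC)
  then show ?thesis
    using g by metis
qed

section \<open>Algebra and norm of adjoints\<close>

lemma adj_eqI:
  fixes X Y :: "'a::complex_hilbert bop"
  assumes "\<And>x y. cinner (X x) y = cinner x (Y y)"
  shows "adj X = Y"
  unfolding adj_def
proof (rule the_equality)
  show "Z = Y" if "\<forall>x y. cinner (X x) y = cinner x (Z y)" for Z :: "'a bop"
    using that assms by (intro bop_eqI cinner_eqI_right) simp
qed (simp add: assms)

lemma cinner_adj_right: "cinner x (adj X y) = cinner (X x) y" for X :: "'a::complex_hilbert bop"
  using adj_exists[of X] adj_eqI[of X] by metis

lemma cinner_adj_left: "cinner (adj X x) y = cinner x (X y)" for X :: "'a::complex_hilbert bop"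
  by (metis cinner_adj_right cinner_commute)

lemma adj_adj [simp]: "adj (adj X) = X"
  by (rule adj_eqI) (rule cinner_adj_left)

lemma adj_one [simp]: "adj 1 = 1"
  by (rule adj_eqI) simp

lemma adj_zero [simp]: "adj 0 = 0"
  by (rule adj_eqI) simp

lemma adj_add [simp]: "adj (X + Y) = adj X + adj Y"
  by (rule adj_eqI) (simp add: cinner_add_left cinner_add_right cinner_adj_right)

lemma adj_diff [simp]: "adj (X - Y) = adj X - adj Y"
  by (rule adj_eqI) (simp add: cinner_diff_left cinner_diff_right cinner_adj_right)

lemma adj_minus [simp]: "adj (- X) = - adj X"
  by (rule adj_eqI) (simp add: cinner_minus_left cinner_minus_right cinner_adj_right)

lemma adj_mult [simp]: "adj (X * Y) = adj Y * adj X"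
  by (rule adj_eqI) (simp add: cinner_adj_right)

lemma adj_scaleR [simp]: "adj (r *\<^sub>R X) = r *\<^sub>R adj X"
  by (rule adj_eqI) (simp add: scaleR_eq_scaleC cinner_scaleC_left cinner_scaleC_right cinner_adj_right)

lemma bop_norm_leI:
  fixes X :: "'a::complex_hilbert bop"
  assumes "\<And>x. norm (X x) \<le> K * norm x" "0 \<le> K"
  shows "norm X \<le> K"
  unfolding norm_bop.rep_eq using assms(2,1) by (rule onorm_bound)

text \<open>Makes \<open>adj\<close> continuous, so that limits of self-adjoint operators are
  self-adjoint.\<close>

lemma norm_adj_le: "norm (adj X) \<le> norm X" for X :: "'a::complex_hilbert bop"
proof (rule bop_norm_leI)
  fix y
  show "norm (adj X y) \<le> norm X * norm y"
  proof (cases "adj X y = 0")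
    case False
    have "(norm (adj X y))\<^sup>2 = cmod (cinner (X (adj X y)) y)"
      by (simp add: cinner_self norm_power flip: cinner_adj_right)
    also have "\<dots> \<le> norm (X (adj X y)) * norm y"
      by (rule cmod_cinner_le)
    also have "\<dots> \<le> norm X * norm (adj X y) * norm y"
      by (intro mult_right_mono bop_norm_le) simp
    finally have "norm (adj X y) * norm (adj X y) \<le> norm (adj X y) * (norm X * norm y)"
      by (simp add: power2_eq_square mult_ac)
    then show ?thesis
      using False by (simp add: mult_le_cancel_left_pos)
  qed simp
qed simp


section \<open>Positive operators\<close>

lemma positive_opD: "positive_op X \<Longrightarrow> 0 \<le> Re (cinner (X x) x)" for X :: "'a::complex_hilbert bop"
  unfolding positive_op_def by (auto simp: complex_nonneg_Reals_iff)

lemma positive_op_selfadjoint: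
  fixes X :: "'a::complex_hilbert bop"
  assumes "positive_op X"
  shows "adj X = X"
proof (rule adj_eqI)
  fix x y
  have im: "Im (cinner (X z) z) = 0" for z
    using assms unfolding positive_op_def by (auto simp: complex_nonneg_Reals_iff)
  \<comment> \<open>Polarization: the quadratic form is real, so the cross terms at x + w have no
    imaginary part. Taking w = y and w = i y then gives the imaginary and the real part of the
    symmetry.\<close>
  have 1: "Im (cinner (X x) w) + Im (cinner (X w) x) = 0" for w
    using im[of "x + w"] im[of x] im[of w]
    by (simp add: bop_add cinner_add_left cinner_add_right)
  have "cinner (X x) y = cnj (cinner (X y) x)"
    using 1[of y] 1[of "\<i> *\<^sub>C y"]
    by (simp add: complex_eq_iff bop_scaleC cinner_scaleC_left cinner_scaleC_right)
  then show "cinner (X x) y = cinner x (X y)"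
    by (metis cinner_commute)
qed

lemma positive_opI:
  fixes X :: "'a::complex_hilbert bop"
  assumes "adj X = X" "\<And>x. 0 \<le> Re (cinner (X x) x)"
  shows "positive_op X"
proof -
  have "cinner (X x) x = cnj (cinner (X x) x)" for x
    by (metis assms(1) cinner_adj_right cinner_commute)
  then have "Im (cinner (X x) x) = 0" for x
    by (simp add: complex_eq_iff)
  then show ?thesis
    using assms(2) by (simp add: positive_op_def complex_nonneg_Reals_iff)
qed

lemma positive_op_add: "positive_op X \<Longrightarrow> positive_op Y \<Longrightarrow> positive_op (X + Y)"
  by (simp add: positive_op_def cinner_add_left complex_nonneg_Reals_iff)

lemma positive_op_adj_mult: "positive_op (adj X * X)"
  by (simp add: positive_op_def cinner_adj_left cinner_self)

lemma positive_op_scaleR: "positive_op X \<Longrightarrow> 0 \<le> r \<Longrightarrow> positive_op (r *\<^sub>R X)"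
  by (simp add: positive_op_def scaleR_eq_scaleC cinner_scaleC_left complex_nonneg_Reals_iff)

lemma positive_op_one_minus:
  assumes "adj X = X" "norm X \<le> 1"
  shows "positive_op (1 - X)"
proof (rule positive_opI)
  show "0 \<le> Re (cinner ((1 - X) x) x)" for x
  proof -
    have "Re (cinner (X x) x) \<le> norm (X x) * norm x"
      using cmod_cinner_le[of "X x" x] complex_Re_le_cmod order_trans by blast
    also have "\<dots> \<le> norm X * norm x * norm x"
      by (intro mult_right_mono bop_norm_le) simp
    also have "\<dots> \<le> (norm x)\<^sup>2"
      using assms(2) by (simp add: power2_eq_square mult_left_le_one_le mult.assoc)
    finally show ?thesis
      by (simp add: cinner_diff_left cinner_self)
  qed
qed (simp add: assms)

text \<open>Expand the inequality \<open>\<langle>X y, y\<rangle> \<ge> 0\<close> at \<open>y = c x - X x\<close>.\<close>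

lemma positive_op_norm_sq_le:
  fixes X :: "'a::complex_hilbert bop"
  assumes "positive_op X" "norm X \<le> c" "0 < c"
  shows "(norm (X x))\<^sup>2 \<le> c * Re (cinner (X x) x)"
proof -
  have [simp]: "cinner y (X z) = cinner (X y) z" for y z
    by (metis assms(1) cinner_adj_right positive_op_selfadjoint)
  define r where "r = Re (cinner (X (X x)) (X x))"
  have "r \<le> norm (X (X x)) * norm (X x)"
    unfolding r_def using cmod_cinner_le complex_Re_le_cmod order_trans by blast
  also have "\<dots> \<le> norm X * norm (X x) * norm (X x)"
    by (intro mult_right_mono bop_norm_le) simp
  also have "\<dots> \<le> c * (norm (X x))\<^sup>2"
    using assms(2) by (simp add: power2_eq_square mult_right_mono mult.assoc)
  finally have r: "r \<le> c * (norm (X x))\<^sup>2" .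
  have nrm: "cinner (X (X x)) x = complex_of_real ((norm (X x))\<^sup>2)"
    using cinner_self[of "X x"] by simp
  have "0 \<le> Re (cinner (X (c *\<^sub>R x - X x)) (c *\<^sub>R x - X x))"
    by (rule positive_opD[OF assms(1)])
  also have "\<dots> = c\<^sup>2 * Re (cinner (X x) x) - 2 * c * (norm (X x))\<^sup>2 + r"
    by (simp add: scaleR_eq_scaleC bop_diff bop_scaleC cinner_diff_left cinner_diff_right
        cinner_scaleC_left cinner_scaleC_right nrm r_def power2_eq_square algebra_simps
        del: of_real_power)
  finally have "c * (norm (X x))\<^sup>2 \<le> c * (c * Re (cinner (X x) x))"
    using r by (simp add: power2_eq_square algebra_simps)
  then show ?thesis
    using assms(3) by (simp add: mult_le_cancel_left_pos)
qed


section \<open>Square roots\<close>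

instance complex_hilbert \<subseteq> banach ..

text \<open>The embedding into the complete space of bounded real-linear maps is isometric, and its
  range is closed because pointwise limits of complex-linear maps are complex-linear.\<close>

instance bop :: (complex_hilbert) banach
proof
  fix X :: "nat \<Rightarrow> 'a bop"
  assume X: "Cauchy X"
  define G where "G n = Blinfun (bop_apply (X n))" for n
  have G: "blinfun_apply (G n) = bop_apply (X n)" for n
    by (simp add: G_def bounded_linear_Blinfun_apply bop_bounded_linear)
  have "dist (G m) (G n) = dist (X m) (X n)" for m n
    by (simp add: dist_norm norm_blinfun.rep_eq norm_bop.rep_eq minus_blinfun.rep_eq G)
  then have "Cauchy G"
    using X by (simp add: Cauchy_def)
  then obtain L where L: "G \<longlonglongrightarrow> L"
    by (auto simp: Cauchy_convergent_iff convergent_def)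
  have "blinfun_apply L (c *\<^sub>C x) = c *\<^sub>C blinfun_apply L x" for c x
  proof -
    have lim: "(\<lambda>n. X n y) \<longlonglongrightarrow> blinfun_apply L y" for y
      using blinfun.tendsto[OF L tendsto_const[of y]] by (simp add: G)
    have "bounded_linear (\<lambda>y :: 'a. c *\<^sub>C y)"
      by (rule bounded_linear_intro[where K = "cmod c"])
        (auto simp: scaleC_add_right scaleC_scaleR_commute norm_scaleC)
    then have "(\<lambda>n. c *\<^sub>C X n x) \<longlonglongrightarrow> c *\<^sub>C blinfun_apply L x"
      by (rule bounded_linear.tendsto) (rule lim)
    then show ?thesis
      using lim[of "c *\<^sub>C x"] by (simp add: bop_scaleC LIMSEQ_unique)
  qed
  then have L': "bop_apply (Bop (blinfun_apply L)) = blinfun_apply L"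
    by (intro Bop_inverse) (simp add: blinfun.bounded_linear_right)
  have "dist (X n) (Bop (blinfun_apply L)) = dist (G n) L" for n
    by (simp add: dist_norm norm_blinfun.rep_eq norm_bop.rep_eq minus_blinfun.rep_eq G L')
  then have "X \<longlonglongrightarrow> Bop (blinfun_apply L)"
    using L by (simp add: tendsto_iff)
  then show "convergent X"
    by (auto simp: convergent_def)
qed

text \<open>The fixed points of \<open>Y \<mapsto> (T + Y\<^sup>2) / 2\<close> are the \<open>Y\<close> with \<open>(1 - Y)\<^sup>2 = 1 - T\<close>. For
  \<open>\<parallel>T\<parallel> \<le> 1\<close> the increments of the iteration are dominated by those of the same scalar iteration
  with \<open>T\<close> replaced by \<open>1\<close>, which increases to \<open>1\<close>.\<close>

primrec sqrt_iter :: "'a::complex_hilbert bop \<Rightarrow> nat \<Rightarrow> 'a bop" where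
  "sqrt_iter T 0 = 0"
| "sqrt_iter T (Suc n) = (1/2) *\<^sub>R (T + sqrt_iter T n * sqrt_iter T n)"

primrec scalar_iter :: "nat \<Rightarrow> real" where
  "scalar_iter 0 = 0"
| "scalar_iter (Suc n) = (1 + scalar_iter n * scalar_iter n) / 2"

lemma scalar_iter_bounds: "0 \<le> scalar_iter n \<and> scalar_iter n \<le> 1"
proof (induction n)
  case (Suc n)
  then have "scalar_iter n * scalar_iter n \<le> 1 * 1"
    by (intro mult_mono) auto
  then show ?case by simp
qed simp

text \<open>Stated for two operators so that it covers both commutation (T' = T) and the passage
  from \<open>C\<close> to the pairs \<open>B\<close>, \<open>B'\<close> and \<open>D\<close>,
  \<open>D'\<close>.\<close>

lemma sqrt_iter_intertwine:
  assumes "K * T = T' * K"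
  shows "K * sqrt_iter T n = sqrt_iter T' n * K"
proof (induction n)
  case (Suc n)
  have "K * (sqrt_iter T n * sqrt_iter T n) = sqrt_iter T' n * sqrt_iter T' n * K"
    by (simp add: Suc flip: mult.assoc) (simp add: Suc mult.assoc)
  then show ?case
    by (simp add: assms distrib_left distrib_right)
qed simp

lemma sqrt_iter_norm_le:
  assumes "norm T \<le> 1"
  shows "norm (sqrt_iter T n) \<le> scalar_iter n"
proof (induction n)
  case (Suc n)
  have "norm (sqrt_iter T n * sqrt_iter T n) \<le> norm (sqrt_iter T n) * norm (sqrt_iter T n)"
    by (rule norm_mult_ineq)
  also have "\<dots> \<le> scalar_iter n * scalar_iter n"
    using Suc scalar_iter_bounds by (intro mult_mono) auto
  finally show ?case
    using norm_triangle_ineq[of T "sqrt_iter T n * sqrt_iter T n"] assms by simp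
qed simp

lemma sqrt_iter_step_le:
  assumes "norm T \<le> 1"
  shows "norm (sqrt_iter T (Suc n) - sqrt_iter T n) \<le> scalar_iter (Suc n) - scalar_iter n"
proof (induction n)
  case (Suc n)
  let ?Y = "sqrt_iter T" and ?y = scalar_iter
  \<comment> \<open>The iterates are polynomials in \<open>T\<close>, so consecutive ones commute
    and the difference of their squares factors.\<close>
  have "?Y n * T = T * ?Y n"
    by (rule sqrt_iter_intertwine[symmetric]) simp
  then have "?Y n * ?Y (Suc n) = ?Y (Suc n) * ?Y n"
    by (simp add: distrib_left distrib_right mult.assoc)
  then have "?Y (Suc n) * ?Y (Suc n) - ?Y n * ?Y n = (?Y (Suc n) + ?Y n) * (?Y (Suc n) - ?Y n)"
    by (simp only: distrib_right right_diff_distrib) simp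
  then have "norm (?Y (Suc (Suc n)) - ?Y (Suc n))
      = norm ((?Y (Suc n) + ?Y n) * (?Y (Suc n) - ?Y n)) / 2"
    unfolding sqrt_iter.simps(2)[of T "Suc n"] sqrt_iter.simps(2)[of T n]
    by (simp flip: scaleR_diff_right)
  also have "\<dots> \<le> norm (?Y (Suc n) + ?Y n) * norm (?Y (Suc n) - ?Y n) / 2"
    by (intro divide_right_mono norm_mult_ineq) simp
  also have "\<dots> \<le> (?y (Suc n) + ?y n) * (?y (Suc n) - ?y n) / 2"
  proof (intro divide_right_mono mult_mono Suc)
    show "norm (?Y (Suc n) + ?Y n) \<le> ?y (Suc n) + ?y n"
      by (rule norm_triangle_mono) (rule sqrt_iter_norm_le[OF assms])+
    show "0 \<le> ?y (Suc n) + ?y n"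
      using scalar_iter_bounds[of n] scalar_iter_bounds[of "Suc n"] by linarith
  qed simp_all
  also have "\<dots> = ?y (Suc (Suc n)) - ?y (Suc n)"
    by (simp only: scalar_iter.simps(2)[of "Suc n"] scalar_iter.simps(2)[of n])
      (simp add: field_simps)
  finally show ?case .
qed (use assms in simp)

lemma sqrt_iter_convergent:
  assumes "norm T \<le> 1"
  shows "convergent (sqrt_iter T)"
proof -
  let ?y = scalar_iter
  \<comment> \<open>Each scalar increment bounds a norm and is therefore nonnegative.\<close>
  have y_inc: "?y n \<le> ?y (Suc n)" for n
    using order_trans[OF norm_ge_zero sqrt_iter_step_le[OF assms, of n]] by simp
  have "convergent ?y"
  proof (rule Bseq_mono_convergent)
    show "Bseq ?y"
      by (rule BseqI[of 1]) (use scalar_iter_bounds in auto)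
    show "\<forall>m n. m \<le> n \<longrightarrow> ?y m \<le> ?y n"
      using lift_Suc_mono_le[of ?y] y_inc by blast
  qed
  then have "Cauchy ?y"
    by (simp add: Cauchy_convergent_iff)
  have bound: "norm (sqrt_iter T (m + k) - sqrt_iter T m) \<le> ?y (m + k) - ?y m" for m k
  proof (induction k)
    case (Suc k)
    have "norm (sqrt_iter T (m + Suc k) - sqrt_iter T m)
        \<le> norm (sqrt_iter T (Suc (m + k)) - sqrt_iter T (m + k)) + norm (sqrt_iter T (m + k) - sqrt_iter T m)"
      using norm_triangle_ineq[of "sqrt_iter T (Suc (m + k)) - sqrt_iter T (m + k)"
          "sqrt_iter T (m + k) - sqrt_iter T m"]
      by (simp del: sqrt_iter.simps)
    then show ?case
      using Suc sqrt_iter_step_le[OF assms, of "m + k"] by (simp del: sqrt_iter.simps scalar_iter.simps)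
  qed simp
  have le: "dist (sqrt_iter T m) (sqrt_iter T n) \<le> dist (?y m) (?y n)" if mn: "m \<le> n" for m n
  proof -
    obtain k where "n = m + k"
      using le_Suc_ex[OF mn] ..
    then show ?thesis
      using bound[of m k]
      by (simp add: dist_norm norm_minus_commute[of "sqrt_iter T m"])
  qed
  have le': "dist (sqrt_iter T m) (sqrt_iter T n) \<le> dist (?y m) (?y n)" for m n
    using le[of m n] le[of n m] nat_le_linear[of m n] by (auto simp: dist_commute)
  have "Cauchy (sqrt_iter T)"
  proof (rule metric_CauchyI)
    fix e :: real assume "0 < e"
    then obtain N where "\<forall>m\<ge>N. \<forall>n\<ge>N. dist (?y m) (?y n) < e"
      using \<open>Cauchy ?y\<close> by (blast dest: metric_CauchyD)
    then show "\<exists>N. \<forall>m\<ge>N. \<forall>n\<ge>N. dist (sqrt_iter T m) (sqrt_iter T n) < e"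
      using le' order_le_less_trans by blast
  qed
  then show ?thesis
    by (simp add: Cauchy_convergent_iff)
qed

lemma tendsto_adj:
  fixes X :: "nat \<Rightarrow> 'a::complex_hilbert bop"
  assumes "X \<longlonglongrightarrow> L"
  shows "(\<lambda>n. adj (X n)) \<longlonglongrightarrow> adj L"
proof -
  have "bounded_linear (adj :: 'a bop \<Rightarrow> 'a bop)"
    by (rule bounded_linear_intro[where K = 1]) (simp_all add: norm_adj_le)
  then show ?thesis
    using assms by (rule bounded_linear.tendsto)
qed

lemma
  fixes T :: "'a::complex_hilbert bop"
  assumes "adj T = T" "norm T \<le> 1"
  shows positive_op_sqrt_iter_limit: "positive_op (1 - lim (sqrt_iter T))"
    and sqrt_iter_limit_square: "(1 - lim (sqrt_iter T)) * (1 - lim (sqrt_iter T)) = 1 - T"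
proof -
  define Y where "Y = lim (sqrt_iter T)"
  have lim: "sqrt_iter T \<longlonglongrightarrow> Y"
    using sqrt_iter_convergent[OF assms(2)] by (simp add: Y_def convergent_LIMSEQ_iff)
  \<comment> \<open>The scalar bound passes to the limit; a self-adjoint contraction
    \<open>Y\<close> makes \<open>1 - Y\<close> positive.\<close>
  have "norm Y \<le> 1"
    by (rule LIMSEQ_le_const2[OF tendsto_norm[OF lim]])
      (meson assms(2) order_trans scalar_iter_bounds sqrt_iter_norm_le)
  moreover have "adj (sqrt_iter T n) = sqrt_iter T n" for n
    by (induction n) (simp_all add: assms(1))
  then have "adj Y = Y"
    using tendsto_adj[OF lim] lim LIMSEQ_unique by simp
  ultimately show "positive_op (1 - lim (sqrt_iter T))"
    unfolding Y_def[symmetric] by (intro positive_op_one_minus)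
  have "(\<lambda>n. sqrt_iter T (Suc n)) \<longlonglongrightarrow> (1/2) *\<^sub>R (T + Y * Y)"
    unfolding sqrt_iter.simps by (intro tendsto_intros lim)
  with LIMSEQ_Suc[OF lim] have "Y = (1/2) *\<^sub>R (T + Y * Y)"
    by (rule LIMSEQ_unique)
  then have "Y + Y = T + Y * Y"
    by (metis scaleR_half_double scaleR_add_right)
  then show "(1 - lim (sqrt_iter T)) * (1 - lim (sqrt_iter T)) = 1 - T"
    unfolding Y_def[symmetric]
    by (simp add: left_diff_distrib right_diff_distrib) (simp add: algebra_simps)
qed

text \<open>The scaling by \<open>c\<close> is kept as a parameter so that two operators can be treated with the same one.\<close>

definition sqrt_approx :: "real \<Rightarrow> 'a::complex_hilbert bop \<Rightarrow> 'a bop"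
  where "sqrt_approx c X = sqrt c *\<^sub>R (1 - lim (sqrt_iter (1 - (1 / c) *\<^sub>R X)))"

text \<open>Expand |(1 - X) x|^2 = |x|^2 - 2 <X x, x> + |X x|^2 and use |X x|^2 <= <X x, x>, the
  case c = 1 of \<open>positive_op_norm_sq_le\<close>.\<close>

lemma norm_one_minus_le:
  assumes "positive_op X" "norm X \<le> 1"
  shows "norm (1 - X) \<le> 1"
proof (rule bop_norm_leI)
  fix x
  have "cinner (X x) x = cinner x (X x)"
    by (metis assms(1) cinner_adj_right positive_op_selfadjoint)
  then have "complex_of_real ((norm ((1 - X) x))\<^sup>2)
      = complex_of_real ((norm x)\<^sup>2) - 2 * cinner (X x) x + complex_of_real ((norm (X x))\<^sup>2)"
    unfolding cinner_self[symmetric] by (simp add: cinner_diff_left cinner_diff_right)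
  then have "(norm ((1 - X) x))\<^sup>2 = (norm x)\<^sup>2 - 2 * Re (cinner (X x) x) + (norm (X x))\<^sup>2"
    by (auto dest: arg_cong[of _ _ Re] simp del: of_real_power)
  also have "\<dots> \<le> (norm x)\<^sup>2"
    using positive_op_norm_sq_le[OF assms, of x] positive_opD[OF assms(1), of x] by simp
  finally have "norm ((1 - X) x) \<le> norm x"
    by (rule power2_le_imp_le) simp
  then show "norm ((1 - X) x) \<le> 1 * norm x"
    by simp
qed simp

lemma scaled_complement:
  assumes "positive_op X" "norm X \<le> c" "0 < c"
  shows "adj (1 - (1 / c) *\<^sub>R X) = 1 - (1 / c) *\<^sub>R X" "norm (1 - (1 / c) *\<^sub>R X) \<le> 1"
proof -
  show "adj (1 - (1 / c) *\<^sub>R X) = 1 - (1 / c) *\<^sub>R X"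
    by (simp add: positive_op_selfadjoint assms(1))
  have "norm ((1 / c) *\<^sub>R X) \<le> 1"
    using assms(2,3) by (simp add: divide_le_eq)
  then show "norm (1 - (1 / c) *\<^sub>R X) \<le> 1"
    using assms by (intro norm_one_minus_le positive_op_scaleR) simp_all
qed

lemma
  assumes "positive_op X" "norm X \<le> c" "0 < c"
  shows positive_op_sqrt_approx: "positive_op (sqrt_approx c X)"
    and sqrt_approx_square: "sqrt_approx c X * sqrt_approx c X = X"
proof -
  note limit = scaled_complement[OF assms]
  show "positive_op (sqrt_approx c X)"
    unfolding sqrt_approx_def using assms(3)
    by (intro positive_op_scaleR positive_op_sqrt_iter_limit limit) simp
  have "sqrt_approx c X * sqrt_approx c X = (sqrt c * sqrt c) *\<^sub>R (1 - (1 - (1 / c) *\<^sub>R X))"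
    unfolding sqrt_approx_def mult_scaleR_left mult_scaleR_right scaleR_scaleR
      sqrt_iter_limit_square[OF limit] ..
  then show "sqrt_approx c X * sqrt_approx c X = X"
    using assms(3) by simp
qed

lemma sqrt_approx_intertwine:
  assumes "positive_op X" "norm X \<le> c" "positive_op Y" "norm Y \<le> c" "0 < c"
    and K: "K * X = Y * K"
  shows "K * sqrt_approx c X = sqrt_approx c Y * K"
proof -
  let ?T = "1 - (1 / c) *\<^sub>R X" and ?T' = "1 - (1 / c) *\<^sub>R Y"
  have lim: "sqrt_iter ?T \<longlonglongrightarrow> lim (sqrt_iter ?T)" "sqrt_iter ?T' \<longlonglongrightarrow> lim (sqrt_iter ?T')"
    using assms by (simp_all add: scaled_complement sqrt_iter_convergent flip: convergent_LIMSEQ_iff)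
  have "K * ?T = ?T' * K"
    using K by (simp add: left_diff_distrib right_diff_distrib)
  then have "K * sqrt_iter ?T n = sqrt_iter ?T' n * K" for n
    by (rule sqrt_iter_intertwine)
  moreover have "(\<lambda>n. K * sqrt_iter ?T n) \<longlonglongrightarrow> K * lim (sqrt_iter ?T)"
    "(\<lambda>n. sqrt_iter ?T' n * K) \<longlonglongrightarrow> lim (sqrt_iter ?T') * K"
    by (intro tendsto_intros lim)+
  ultimately have "K * lim (sqrt_iter ?T) = lim (sqrt_iter ?T') * K"
    using LIMSEQ_unique by auto
  then show ?thesis
    by (simp add: sqrt_approx_def left_diff_distrib right_diff_distrib)
qed

section \<open>Uniqueness and intertwining of positive square roots\<close>

lemma positive_op_eq_zeroI:
  assumes "positive_op X" "Re (cinner (X x) x) = 0"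
  shows "X x = 0"
proof -
  \<comment> \<open>The norm itself may vanish, while the estimate needs a strictly positive
    constant.\<close>
  have "0 < norm X + 1"
    by (simp add: add_nonneg_pos)
  then have "(norm (X x))\<^sup>2 \<le> (norm X + 1) * Re (cinner (X x) x)"
    by (intro positive_op_norm_sq_le[OF assms(1)]) simp_all
  then show ?thesis
    unfolding assms(2) by simp
qed

text \<open>By commutation R + S kills y = (R - S) x. Positivity then gives <R y, y> = <S y, y> = 0,
  hence R y = S y = 0, and |y|^2 = <x, (R - S) y> = 0.\<close>

lemma positive_square_root_unique:
  assumes R: "positive_op R" "positive_op S" and eq: "R * R = S * S" and comm: "R * S = S * R"
  shows "R = S"
proof (rule bop_eqI)
  fix x
  define y where "y = (R - S) x"
  have "(R + S) * (R - S) = 0"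
    using eq comm by (simp add: distrib_right right_diff_distrib)
  then have "(R + S) y = 0"
    unfolding y_def by (metis times_bop.rep_eq zero_bop.rep_eq)
  then have "cinner (R y) y + cinner (S y) y = 0"
    by (simp flip: cinner_add_left)
  then have "Re (cinner (R y) y) + Re (cinner (S y) y) = 0"
    by (auto dest: arg_cong[of _ _ Re])
  then have "R y = 0" "S y = 0"
    using positive_opD[OF R(1), of y] positive_opD[OF R(2), of y]
    by (auto intro!: positive_op_eq_zeroI R)
  then have "cinner x ((R - S) y) = 0"
    by simp
  then have "cinner (adj (R - S) x) y = 0"
    by (simp only: cinner_adj_left)
  then have "cinner y y = 0"
    using R by (simp add: y_def positive_op_selfadjoint)
  then show "R x = S x"
    by (simp add: cinner_self y_def)
qed

lemma sqrt_op_eq: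
  assumes "positive_op X" "norm X \<le> c" "0 < c"
  shows "sqrt_op X = sqrt_approx c X"
  unfolding sqrt_op_def
proof (rule the_equality)
  fix S assume "positive_op S \<and> S * S = X"
  then have S: "positive_op S" "S * S = X"
    by simp_all
  \<comment> \<open>A root commutes with its square \<open>X\<close>, hence with a limit of
    polynomials in \<open>X\<close>; this supplies the commutation that uniqueness asks for.\<close>
  have "S * X = X * S"
    unfolding S(2)[symmetric] by (rule mult.assoc[symmetric])
  then have comm: "S * sqrt_approx c X = sqrt_approx c X * S"
    using assms by (intro sqrt_approx_intertwine)
  have "S * S = sqrt_approx c X * sqrt_approx c X"
    unfolding S(2) sqrt_approx_square[OF assms] ..
  then show "S = sqrt_approx c X"
    by (rule positive_square_root_unique[OF S(1) positive_op_sqrt_approx[OF assms] _ comm])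
qed (simp add: assms positive_op_sqrt_approx sqrt_approx_square)

lemma
  assumes "positive_op X"
  shows positive_op_sqrt_op: "positive_op (sqrt_op X)"
    and sqrt_op_square: "sqrt_op X * sqrt_op X = X"
proof -
  have "norm X \<le> norm X + 1" "0 < norm X + 1"
    by (simp_all add: add_nonneg_pos)
  note * = assms this
  show "positive_op (sqrt_op X)" "sqrt_op X * sqrt_op X = X"
    by (simp_all add: sqrt_op_eq[OF *] positive_op_sqrt_approx[OF *] sqrt_approx_square[OF *])
qed

lemma sqrt_op_intertwine:
  assumes "positive_op X" "positive_op Y" "K * X = Y * K"
  shows "K * sqrt_op X = sqrt_op Y * K"
proof -
  define c where "c = norm X + norm Y + 1"
  have c: "norm X \<le> c" "norm Y \<le> c" "0 < c"
    unfolding c_def using norm_ge_zero[of X] norm_ge_zero[of Y] by linarith+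
  show ?thesis
    using assms c by (simp add: sqrt_op_eq[of _ c] sqrt_approx_intertwine)
qed

section \<open>Inverses and inverse square roots\<close>

lemma inv_op_eqI:
  assumes "X * Y = 1" "Y * X = 1"
  shows "inv_op X = Y"
  unfolding inv_op_def
proof (rule the_equality)
  show "Z = Y" if "X * Z = 1 \<and> Z * X = 1" for Z
  proof -
    have "Z = Y * X * Z" using assms by simp
    also have "\<dots> = Y" using that by (simp add: mult.assoc)
    finally show ?thesis .
  qed
qed (use assms in simp)

lemma inv_op_right:
  assumes "invertible_op X"
  shows "X * inv_op X = 1"
proof -
  obtain Y where Y: "X * Y = 1" "Y * X = 1"
    using assms unfolding invertible_op_def by blast
  then show ?thesis
    unfolding inv_op_eqI[OF Y] by simp
qed

lemma inv_op_left:
  assumes "invertible_op X"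
  shows "inv_op X * X = 1"
proof -
  obtain Y where Y: "X * Y = 1" "Y * X = 1"
    using assms unfolding invertible_op_def by blast
  then show ?thesis
    unfolding inv_op_eqI[OF Y] by simp
qed

lemma inv_op_intertwine:
  assumes "invertible_op X" "invertible_op Y" "K * X = Y * K"
  shows "K * inv_op X = inv_op Y * K"
proof -
  have "K * inv_op X = inv_op Y * (Y * K) * inv_op X"
    by (simp add: inv_op_left assms flip: mult.assoc)
  also have "\<dots> = inv_op Y * K * (X * inv_op X)"
    by (simp add: assms(3)[symmetric] mult.assoc)
  finally show ?thesis
    by (simp add: inv_op_right assms)
qed

text \<open>The inverse is the root times \<open>inv_op X\<close>; on the left this uses that the
  root commutes with \<open>inv_op X\<close>.\<close>

lemma invertible_sqrt_op:
  assumes "positive_op X" "invertible_op X"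
  shows "invertible_op (sqrt_op X)"
  unfolding invertible_op_def
proof (intro exI conjI)
  show "sqrt_op X * (sqrt_op X * inv_op X) = 1"
    using assms by (simp add: inv_op_right sqrt_op_square flip: mult.assoc)
  have "sqrt_op X * X = X * sqrt_op X"
    by (rule sqrt_op_intertwine[symmetric]) (simp_all add: assms)
  then have "sqrt_op X * inv_op X = inv_op X * sqrt_op X"
    using assms by (intro inv_op_intertwine)
  then show "sqrt_op X * inv_op X * sqrt_op X = 1"
    using assms by (simp add: inv_op_left sqrt_op_square mult.assoc)
qed

lemma adj_inv_op:
  assumes "adj X = X" "invertible_op X"
  shows "adj (inv_op X) = inv_op X"
proof -
  have "adj (inv_op X * X) = 1" "adj (X * inv_op X) = 1"
    unfolding inv_op_left[OF assms(2)] inv_op_right[OF assms(2)] by (fact adj_one)+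
  then have "X * adj (inv_op X) = 1" "adj (inv_op X) * X = 1"
    unfolding adj_mult assms(1) .
  then show ?thesis
    by (rule inv_op_eqI[symmetric])
qed

lemma inv_sqrt_op_square:
  assumes "positive_op X" "invertible_op X"
  shows "inv_op (sqrt_op X) * inv_op (sqrt_op X) * X = 1"
proof -
  let ?S = "sqrt_op X"
  have "inv_op ?S * inv_op ?S * X = inv_op ?S * inv_op ?S * (?S * ?S)"
    using assms by (simp add: sqrt_op_square)
  also have "\<dots> = inv_op ?S * (inv_op ?S * ?S) * ?S"
    by (simp only: mult.assoc)
  finally show ?thesis
    using assms by (simp add: inv_op_left invertible_sqrt_op)
qed

lemma adj_inv_sqrt_op:
  assumes "positive_op X" "invertible_op X"
  shows "adj (inv_op (sqrt_op X)) = inv_op (sqrt_op X)"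
  using assms by (intro adj_inv_op) (simp_all add: positive_op_selfadjoint positive_op_sqrt_op invertible_sqrt_op)

text \<open>Source of the commutation and intertwining rules for \<open>B\<close>, \<open>B'\<close>
  and the inverse root of \<open>A\<close>.\<close>

lemma inv_sqrt_op_intertwine:
  assumes "positive_op X" "invertible_op X" "positive_op Y" "invertible_op Y" "K * X = Y * K"
  shows "K * inv_op (sqrt_op X) = inv_op (sqrt_op Y) * K"
  using assms by (intro inv_op_intertwine invertible_sqrt_op sqrt_op_intertwine)


section \<open>Operators on two-sided sequences\<close>

lemma ell2Z_eqI: "(\<And>i. coord x i = coord y i) \<Longrightarrow> x = y"
  by (simp add: coord_inject[symmetric] fun_eq_iff)

lemma cinner_emb_left: "cinner (emb i x) z = cinner x (coord z i)"
proof -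
  have "cinner (emb i x) z = (\<Sum>\<^sub>\<infinity>n\<in>{i}. cinner x (coord z i))"
    unfolding cinner_ell2Z_def emb.rep_eq by (rule infsum_cong_neutral) auto
  then show ?thesis
    by simp
qed

lemma cinner_emb_right: "cinner z (emb i x) = cinner (coord z i) x"
  by (metis cinner_commute cinner_emb_left)

text \<open>Blocks determine the coordinates of \<open>adj U (emb i y)\<close>, and pairing with
  these vectors recovers the i-th coordinate of every \<open>U x\<close>. No density of finitely
  supported sequences is involved.\<close>

lemma block_eqI:
  fixes U V :: "'a::complex_hilbert ell2Z bop"
  assumes "\<And>i j. block U i j = block V i j"
  shows "U = V"
proof (rule bop_eqI, rule ell2Z_eqI, rule cinner_eqI_left)
  fix x i y
  have *: "cinner e (coord (adj W (emb i y)) j) = cinner (block W i j e) y"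
    for W :: "'a ell2Z bop" and j e
    by (simp add: block.rep_eq cinner_adj_right flip: cinner_emb_left cinner_emb_right)
  have "adj U (emb i y) = adj V (emb i y)"
    by (rule ell2Z_eqI, rule cinner_eqI_right) (simp add: * assms)
  then show "cinner (coord (U x) i) y = cinner (coord (V x) i) y"
    by (metis cinner_adj_right cinner_emb_right)
qed

text \<open>Discharges the definite description once an explicit operator with the prescribed blocks
  is at hand.\<close>

lemma op_of_blocks_eqI:
  assumes "\<And>i j. block U i j = M i j"
  shows "op_of_blocks M = U"
  unfolding op_of_blocks_def
  by (rule the_equality) (auto intro: block_eqI simp: assms)

lemma orth_proj_emb: "orth_proj (range (emb i)) v = emb i (coord v i)"
  unfolding orth_proj_def
proof (rule the_equality)
  show "emb i (coord v i) \<in> range (emb i) \<and>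
      (\<forall>z\<in>range (emb i). cinner (v - emb i (coord v i)) z = 0)"
    by (auto simp: cinner_emb_right minus_ell2Z.rep_eq emb.rep_eq)
next
  fix y assume y: "y \<in> range (emb i) \<and> (\<forall>z\<in>range (emb i). cinner (v - y) z = 0)"
  then obtain a where a: "y = emb i a" by blast
  have "cinner (coord v i) b = cinner a b" for b
  proof -
    have "cinner (v - y) (emb i b) = 0" using y by blast
    then show ?thesis
      by (simp add: a cinner_emb_right minus_ell2Z.rep_eq emb.rep_eq cinner_diff_left)
  qed
  then show "y = emb i (coord v i)"
    unfolding a by (metis cinner_eqI_left)
qed

lemma unitary_op_mult:
  assumes "unitary_op U" "unitary_op V"
  shows "unitary_op (U * V)"
proof -
  have "adj (U * V) * (U * V) = adj V * (adj U * U) * V"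
    "(U * V) * adj (U * V) = U * (V * adj V) * adj U"
    by (simp_all add: mult.assoc)
  then show ?thesis
    using assms by (simp add: unitary_op_def)
qed

section \<open>The bilateral shift\<close>

lift_definition shift_vec :: "int \<Rightarrow> 'a::complex_hilbert ell2Z \<Rightarrow> 'a ell2Z" is "\<lambda>k f n. f (n - k)"
proof -
  fix k :: int and f :: "int \<Rightarrow> 'a"
  assume "(\<lambda>n. (norm (f n))\<^sup>2) summable_on UNIV"
  moreover have "bij_betw (\<lambda>n :: int. n - k) UNIV UNIV"
    by (rule bij_betw_byWitness[where f' = "\<lambda>n. n + k"]) auto
  ultimately show "(\<lambda>n. (norm (f (n - k)))\<^sup>2) summable_on UNIV"
    using summable_on_reindex_bij_betw[of "\<lambda>n. n - k" UNIV UNIV "\<lambda>n. (norm (f n))\<^sup>2"] by simp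
qed

lemma cinner_shift_vec: "cinner (shift_vec k x) y = cinner x (shift_vec (- k) y)"
proof -
  have "bij_betw (\<lambda>n :: int. n + k) UNIV UNIV"
    by (rule bij_betw_byWitness[where f' = "\<lambda>n. n - k"]) auto
  then show ?thesis
    unfolding cinner_ell2Z_def shift_vec.rep_eq
    using infsum_reindex_bij_betw[of "\<lambda>n. n + k" UNIV UNIV
        "\<lambda>n. cinner (coord x (n - k)) (coord y n)"] by simp
qed

lemma shift_vec_inverse: "shift_vec (- k) (shift_vec k x) = x"
  by (rule ell2Z_eqI) (simp add: shift_vec.rep_eq)

lemma norm_shift_vec: "norm (shift_vec k x) = norm x"
proof -
  have "complex_of_real ((norm (shift_vec k x))\<^sup>2) = complex_of_real ((norm x)\<^sup>2)"
    unfolding cinner_self[symmetric] cinner_shift_vec shift_vec_inverse ..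
  then show ?thesis
    by (simp only: of_real_eq_iff) (simp add: power2_eq_iff_nonneg)
qed

lift_definition shift :: "int \<Rightarrow> 'a::complex_hilbert ell2Z bop" is shift_vec
proof
  fix k :: int
  show "bounded_linear (shift_vec k :: 'a ell2Z \<Rightarrow> 'a ell2Z)"
    by (rule bounded_linear_intro[where K = 1]; (rule ell2Z_eqI)?)
      (simp_all add: shift_vec.rep_eq plus_ell2Z.rep_eq scaleR_ell2Z.rep_eq norm_shift_vec)
  show "\<forall>c (x :: 'a ell2Z). shift_vec k (c *\<^sub>C x) = c *\<^sub>C shift_vec k x"
    by (intro allI ell2Z_eqI) (simp add: shift_vec.rep_eq scaleC_ell2Z.rep_eq)
qed

lemma coord_shift: "coord (shift k x) i = coord x (i - k)"
  by (simp add: shift.rep_eq shift_vec.rep_eq)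

lemma unitary_op_shift: "unitary_op (shift k)"
proof -
  have adj: "adj (shift k) = shift (- k)"
    by (rule adj_eqI) (simp add: shift.rep_eq cinner_shift_vec)
  show ?thesis
    unfolding unitary_op_def adj
    by (auto intro!: bop_eqI ell2Z_eqI simp: coord_shift)
qed

section \<open>Two-by-two block operators padded by the identity\<close>

lift_definition unit_block :: "int \<Rightarrow> int \<Rightarrow> 'a::complex_hilbert bop \<Rightarrow> 'a ell2Z bop"
  is "\<lambda>i j X x. emb i (X (coord x j))"
  by (simp add: bounded_linear_compose[OF bounded_linear_emb] bounded_linear_compose[OF _ bounded_linear_coord]
      scaleC_ell2Z.rep_eq emb_scaleC)

lemma adj_unit_block [simp]: "adj (unit_block i j X) = unit_block j i (adj X)"
  by (rule adj_eqI) (simp add: unit_block.rep_eq cinner_emb_left cinner_emb_right cinner_adj_right)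

text \<open>The matrix with rows (a, b), (c, d) on the summands k and k + 1. Writing it as a
  correction of the identity makes it bounded by construction and lets adjoints be taken
  termwise.\<close>

definition pair_op ::
    "int \<Rightarrow> 'a::complex_hilbert bop \<Rightarrow> 'a bop \<Rightarrow> 'a bop \<Rightarrow> 'a bop \<Rightarrow> 'a ell2Z bop"
  where "pair_op k a b c d = 1 + unit_block k k (a - 1) + unit_block k (k + 1) b
    + unit_block (k + 1) k c + unit_block (k + 1) (k + 1) (d - 1)"

lemma coord_pair_op:
  "coord (pair_op k a b c d x) i =
    (if i = k then a (coord x k) + b (coord x (k + 1))
     else if i = k + 1 then c (coord x k) + d (coord x (k + 1))
     else coord x i)"
  by (auto simp: pair_op_def unit_block.rep_eq plus_ell2Z.rep_eq emb.rep_eq)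

lemma adj_pair_op: "adj (pair_op k a b c d) = pair_op k (adj a) (adj c) (adj b) (adj d)"
  by (simp add: pair_op_def add_ac)

lemma pair_op_mult:
  "pair_op k a b c d * pair_op k a' b' c' d' =
    pair_op k (a * a' + b * c') (a * b' + b * d') (c * a' + d * c') (c * b' + d * d')"
  by (intro bop_eqI ell2Z_eqI) (auto simp: coord_pair_op bop_add add_ac)

lemma pair_op_one: "pair_op k 1 0 0 1 = 1"
  by (intro bop_eqI ell2Z_eqI) (simp add: coord_pair_op)

lemma unitary_op_pair_op:
  assumes "adj a * a + adj c * c = 1" "adj a * b + adj c * d = 0" "adj b * b + adj d * d = 1"
    "a * adj a + b * adj b = 1" "a * adj c + b * adj d = 0" "c * adj c + d * adj d = 1"
  shows "unitary_op (pair_op k a b c d)"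
proof -
  \<comment> \<open>The two missing off-diagonal entries are adjoints of assumed ones.\<close>
  have "adj b * a + adj d * c = adj (adj a * b + adj c * d)"
    "c * adj a + d * adj b = adj (a * adj c + b * adj d)"
    by simp_all
  then have "adj b * a + adj d * c = 0" "c * adj a + d * adj b = 0"
    using assms by simp_all
  then show ?thesis
    by (simp add: unitary_op_def adj_pair_op pair_op_mult pair_op_one assms)
qed


section \<open>The dilation\<close>

lemma power_mult_distrib_commuting:
  fixes x y :: "'a::monoid_mult"
  assumes "x * y = y * x"
  shows "(x * y) ^ n = x ^ n * y ^ n"
proof (induction n)
  case (Suc n)
  have "(x * y) ^ Suc n = x * (y * x ^ n) * y ^ n"
    by (simp add: Suc mult.assoc)
  also have "y * x ^ n = x ^ n * y"
    using assms by (rule power_commuting_commutes[symmetric])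
  finally show ?case
    by (simp add: mult.assoc)
qed simp

lemma power_intertwine:
  fixes x y z :: "'a::monoid_mult"
  assumes "z * x = y * z"
  shows "z * x ^ n = y ^ n * z"
proof (induction n)
  case (Suc n)
  have "z * x ^ Suc n = y * (z * x ^ n)"
    by (simp add: assms flip: mult.assoc)
  also have "\<dots> = y ^ Suc n * z"
    by (simp add: Suc mult.assoc)
  finally show ?case .
qed simp

text \<open>Companion of a rule x y = z w that lets the simplifier apply it inside a right-nested
  product.\<close>

lemma mult_eq_assoc:
  fixes x y z w v :: "'a::semigroup_mult"
  assumes "x * y = z * w"
  shows "x * (y * v) = z * (w * v)"
  by (metis assms mult.assoc)

text \<open>Collects the algebraic relations among the operators, without roots or inverses, so that
  the rest is computation with words.\<close>

locale dilation_data =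
  fixes A B B' C D D' E :: "'h::complex_hilbert bop"
  assumes selfadjoint [simp]: "adj A = A" "adj B = B" "adj B' = B'" "adj D = D" "adj D' = D'"
    and A_commutes: "A * B = B * A" "A * B' = B' * A" "A * C = C * A" "A * D = D * A" "A * D' = D' * A"
    and BD: "B * D = D * B" "B' * D' = D' * B'"
    and C_intertwines: "C * B = B' * C" "C * D = D' * C"
    and defect: "D * D = 1 - adj C * C" "D' * D' = 1 - C * adj C"
    and E_def: "E = A - 1"
    and normalised: "B * B * (D * D + E * E * adj C * C) = 1" "B' * B' * (D' * D' + E * E * C * adj C) = 1"
begin

lemma adj_E [simp]: "adj E = E"
  by (simp add: E_def)

lemma adj_C_intertwines: "adj C * B' = B * adj C" "adj C * D' = D * adj C" "A * adj C = adj C * A"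
  using arg_cong[OF C_intertwines(1), of adj] arg_cong[OF C_intertwines(2), of adj]
    arg_cong[OF A_commutes(3), of adj]
  by simp_all

lemma E_commutes: "E * B = B * E" "E * B' = B' * E" "E * C = C * E" "E * D = D * E" "E * D' = D' * E"
    "E * adj C = adj C * E"
  by (simp_all add: E_def left_diff_distrib right_diff_distrib A_commutes adj_C_intertwines)

text \<open>These rules sort every word into the order \<open>B, B'\<close>, then \<open>D, D'\<close>, then \<open>C, C\<^sup>*\<close>, then \<open>E\<close>.\<close>

lemmas sort_rules = BD[symmetric] C_intertwines adj_C_intertwines(1,2) E_commutes
lemmas sort_word = mult.assoc sort_rules sort_rules[THEN mult_eq_assoc]

text \<open>The normalisation in the normal form that \<open>sort_word\<close> produces, ready for
  the diagonal entries of the unitarity check.\<close>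

lemma normalised_sorted:
  "B * (B * (D * D)) + B * (B * (adj C * (C * (E * E)))) = 1"
  "B' * (B' * (D' * D')) + B' * (B' * (C * (adj C * (E * E)))) = 1"
  using normalised by (simp_all add: sort_word distrib_left)

text \<open>The Julia operator acts on summands 0 and 1 and leaves its first output in summand 0,
  where the second matrix, on summands -1 and 0, picks it up. The shift then moves the outputs to
  rows 0, 1, 2.\<close>

definition "dilation = shift 1 * (pair_op (- 1) (- (E * B * adj C)) (B * D) (B' * D') (E * C * B)
  * pair_op 0 C D' D (- adj C))"

lemma unitary_dilation_op: "unitary_op dilation"
  unfolding dilation_def
proof (intro unitary_op_mult unitary_op_shift unitary_op_pair_op)
  let ?a = "- (E * B * adj C)" and ?b = "B * D" and ?c = "B' * D'" and ?d = "E * C * B"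
  show "adj ?a * ?a + adj ?c * ?c = 1" "adj ?b * ?b + adj ?d * ?d = 1"
    "?a * adj ?a + ?b * adj ?b = 1" "?c * adj ?c + ?d * adj ?d = 1"
    using normalised_sorted by (simp_all add: sort_word add.commute)
  \<comment> \<open>Once sorted, the two words of each sum are equal with opposite signs.\<close>
  show "adj ?a * ?b + adj ?c * ?d = 0" "?a * adj ?c + ?b * adj ?d = 0"
    by (simp_all add: sort_word)
qed (simp_all add: defect C_intertwines adj_C_intertwines)

lemma coord_dilation:
  "coord (dilation v) i =
    (if i = 0 then B (D (C (coord v 0) + D' (coord v 1))) - E (B (adj C (coord v (- 1))))
     else if i = 1 then E (C (B (C (coord v 0) + D' (coord v 1)))) + B' (D' (coord v (- 1)))
     else if i = 2 then D (coord v 0) - adj C (coord v 1)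
     else coord v (i - 1))"
  by (auto simp: dilation_def coord_shift coord_pair_op)

text \<open>The part of \<open>v\<close> in the summands \<open>0\<close> and \<open>1\<close> enters the summand \<open>0\<close> of \<open>dilation v\<close> only through
  \<open>C v\<^sub>0 + D' v\<^sub>1\<close>, and this vector evolves autonomously.\<close>

lemma dilation_power_invariant:
  "(\<forall>j<0. coord ((dilation ^ n) (emb 0 x)) j = 0) \<and>
    C (coord ((dilation ^ n) (emb 0 x)) 0) + D' (coord ((dilation ^ n) (emb 0 x)) 1)
      = ((A * (C * (B * D))) ^ n * C) x"
proof (induction n)
  case 0
  show ?case by (simp add: emb.rep_eq)
next
  case (Suc n)
  define v where "v = (dilation ^ n) (emb 0 x)"
  define w where "w = C (coord v 0) + D' (coord v 1)"
  \<comment> \<open>The second word sorts to \<open>E\<close> times the first, because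
    \<open>D'\<close> and \<open>B'\<close> pass through \<open>C\<close> to \<open>D\<close> and
    \<open>B\<close>; and \<open>1 + E = A\<close>.\<close>
  have step: "C * (B * D) + D' * (E * (C * B)) = A * (C * (B * D))"
  proof -
    have "A = E + 1" by (simp add: E_def)
    then show ?thesis
      by (simp add: distrib_right sort_word add.commute)
  qed
  \<comment> \<open>The vanishing of negative coordinates is carried through the induction for this:
    without input from summand -1, the new coordinates 0 and 1 depend on \<open>w\<close>
    alone.\<close>
  have v: "coord v (- 1) = 0" and w: "w = ((A * (C * (B * D))) ^ n * C) x"
    using Suc by (simp_all add: v_def w_def)
  have Sv: "(dilation ^ Suc n) (emb 0 x) = dilation v"
    by (simp add: v_def)
  have "coord (dilation v) 0 = B (D w)" "coord (dilation v) 1 = E (C (B w))"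
    by (simp_all add: coord_dilation v w_def)
  then have "C (coord (dilation v) 0) + D' (coord (dilation v) 1) = (C * (B * D) + D' * (E * (C * B))) w"
    by simp
  also have "\<dots> = ((A * (C * (B * D))) ^ Suc n * C) x"
    unfolding step w by (simp add: mult.assoc)
  finally show ?case
    using Suc unfolding Sv by (auto simp: coord_dilation v_def[symmetric])
qed

text \<open>By the invariant the coordinate is \<open>B * D * ?H ^ n * C\<close> at x; sliding
  \<open>B * D\<close> through the power turns \<open>?H\<close> into \<open>A * ?G\<close>, and
  \<open>A\<close> commutes with \<open>?G\<close>.\<close>

lemma coord_dilation_power_Suc:
  "coord ((dilation ^ Suc n) (emb 0 x)) 0 = (A ^ n * (B * D * C) ^ Suc n) x"
proof -
  let ?H = "A * (C * (B * D))" and ?G = "B * D * C"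
  have "coord ((dilation ^ Suc n) (emb 0 x)) 0 = (B * D * ?H ^ n * C) x"
    using dilation_power_invariant[of n x] by (simp add: coord_dilation)
  also have "B * D * ?H ^ n = (A * ?G) ^ n * (B * D)"
  proof (rule power_intertwine)
    have "B * D * A = A * (B * D)"
      by (simp add: mult.assoc A_commutes[symmetric] A_commutes[symmetric, THEN mult_eq_assoc])
    then have "B * D * ?H = A * (B * D) * (C * (B * D))"
      by (simp flip: mult.assoc)
    then show "B * D * ?H = A * ?G * (B * D)"
      by (simp add: mult.assoc)
  qed
  also have "(A * ?G) ^ n = A ^ n * ?G ^ n"
    by (rule power_mult_distrib_commuting)
      (simp add: mult.assoc A_commutes A_commutes[THEN mult_eq_assoc])
  finally show ?thesis
    by (simp add: mult.assoc power_Suc2 del: power_Suc)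
qed

end

text \<open>The classical passage between 1 + XY and 1 + YX with its explicit inverse. It makes
  \<open>B'\<close> well defined from the hypothesis on \<open>B\<close>.\<close>

lemma invertible_op_swap:
  assumes K: "K * C = C * K" "K * adj C = adj C * K" and inv: "invertible_op (1 + K * adj C * C)"
  shows "invertible_op (1 + K * C * adj C)"
proof -
  obtain Y where Y: "(1 + K * adj C * C) * Y = 1" "Y * (1 + K * adj C * C) = 1"
    using inv by (auto simp: invertible_op_def)
  let ?Z = "1 - K * C * Y * adj C"
  have "(1 + K * C * adj C) * ?Z = 1 + K * C * adj C - K * C * ((1 + K * adj C * C) * Y) * adj C"
    "?Z * (1 + K * C * adj C) = 1 + K * C * adj C - K * C * (Y * (1 + K * adj C * C)) * adj C"
    by (simp_all add: distrib_left distrib_right left_diff_distrib right_diff_distrib mult.assoc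
        K[symmetric] K[symmetric, THEN mult_eq_assoc])
  then show ?thesis
    unfolding invertible_op_def using Y by (intro exI[of _ ?Z]) simp
qed

theorem theorem5p5:
  fixes A B B' C D D' T :: "'h::complex_hilbert bop"
    and M :: "int \<Rightarrow> int \<Rightarrow> 'h bop"
    and U :: "'h ell2Z bop"
    and S :: "nat \<Rightarrow> 'h bop"
  assumes "A * C = C * A"
    and "positive_op A"
    and "invertible_op A"
    and "norm C \<le> 1"
    and "invertible_op (1 + A * (A - 2 *\<^sub>R 1) * adj C * C)"
    and "B = inv_op (sqrt_op (1 + A * (A - 2 *\<^sub>R 1) * adj C * C))"
    and "B' = inv_op (sqrt_op (1 + A * (A - 2 *\<^sub>R 1) * C * adj C))"
    and "D = sqrt_op (1 - adj C * C)"
    and "D' = sqrt_op (1 - C * adj C)"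
    and "T = A * B * D * C"
    and "M = (\<lambda>i j.
          if (i, j) = (0, -1) then - (A - 1) * B * adj C
          else if (i, j) = (0, 0) then B * D * C
          else if (i, j) = (0, 1) then B * D * D'
          else if (i, j) = (1, -1) then B' * D'
          else if (i, j) = (1, 0) then (A - 1) * C * B * C
          else if (i, j) = (1, 1) then (A - 1) * C * B * D'
          else if (i, j) = (2, -1) then 0
          else if (i, j) = (2, 0) then D
          else if (i, j) = (2, 1) then - adj C
          else if i = j + 1 \<and> (j \<le> -2 \<or> j \<ge> 2) then 1
          else 0)"
    and "U = op_of_blocks M"
    and "S = (\<lambda>n. if n = 0 then 1 else inv_op (sqrt_op A) * T ^ n * inv_op (sqrt_op A))"
  shows "(\<forall>i j. block U i j = M i j)
    \<and> unitary_dilation U S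
    \<and> (\<forall>n\<ge>1. S n = A ^ (n - 1) * (B * D * C) ^ n)"
proof -
  define E where "E = A - 1"
  let ?c = "adj C" and ?K = "A * (A - 2 *\<^sub>R 1)"
  let ?N = "1 + ?K * ?c * C" and ?N' = "1 + ?K * C * ?c"
  have adj_A [simp]: "adj A = A"
    using assms(2) by (rule positive_op_selfadjoint)
  have [simp]: "adj E = E"
    by (simp add: E_def)
  have Ac: "A * ?c = ?c * A"
    using arg_cong[OF assms(1), of adj] by simp
  have EC: "E * C = C * E" "E * ?c = ?c * E"
    by (simp_all add: E_def left_diff_distrib right_diff_distrib assms(1) Ac)
  \<comment> \<open>Completing the square turns \<open>?N\<close> into the defect plus
    \<open>E * E * ?c * C\<close>, both positive; likewise \<open>?N'\<close>.\<close>
  have K: "?K = E * E - 1"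
    by (simp add: E_def left_diff_distrib right_diff_distrib distrib_left scaleR_2)
  have KC: "?K * C = C * ?K" "?K * ?c = ?c * ?K"
    unfolding K by (simp_all add: left_diff_distrib right_diff_distrib mult.assoc EC EC[THEN mult_eq_assoc])
  have N: "?N = (1 - ?c * C) + E * E * ?c * C" "?N' = (1 - C * ?c) + E * E * C * ?c"
    unfolding K by (simp_all add: left_diff_distrib)
  have nC: "norm ?c \<le> 1"
    using norm_adj_le[of C] assms(4) by simp
  have "norm (?c * C) \<le> 1" "norm (C * ?c) \<le> 1"
    using norm_mult_ineq[of ?c C] norm_mult_ineq[of C ?c] mult_le_one[OF nC norm_ge_zero assms(4)]
    by (simp_all add: mult.commute[of "norm C"])
  then have P: "positive_op (1 - ?c * C)" "positive_op (1 - C * ?c)"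
    by (auto intro!: positive_op_one_minus)
  have "E * E * ?c * C = adj (E * C) * (E * C)" "E * E * C * ?c = adj (E * ?c) * (E * ?c)"
    by (simp_all add: mult.assoc EC EC[THEN mult_eq_assoc])
  then have PN: "positive_op ?N" "positive_op ?N'"
    unfolding N by (metis P positive_op_add positive_op_adj_mult)+
  have IN': "invertible_op ?N'"
    using KC assms(5) by (rule invertible_op_swap)
  note B = PN(1) assms(5) and B' = PN(2) IN'
  have AE: "A * E = E * A"
    by (simp add: E_def left_diff_distrib right_diff_distrib)
  note A_rules = assms(1) Ac AE
  have AR: "A * (1 - ?c * C) = (1 - ?c * C) * A" "A * (1 - C * ?c) = (1 - C * ?c) * A"
    by (simp_all add: left_diff_distrib right_diff_distrib mult.assoc A_rules A_rules[THEN mult_eq_assoc])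
  have AN: "A * ?N = ?N * A" "A * ?N' = ?N' * A"
    unfolding N distrib_left distrib_right AR
    by (simp_all add: mult.assoc A_rules A_rules[THEN mult_eq_assoc])
  have AB: "A * B = B * A" "A * B' = B' * A"
    unfolding assms(6,7) by (rule inv_sqrt_op_intertwine[OF B B AN(1)] inv_sqrt_op_intertwine[OF B' B' AN(2)])+
  have AD: "A * D = D * A" "A * D' = D' * A"
    unfolding assms(8,9) by (rule sqrt_op_intertwine[OF P(1) P(1) AR(1)] sqrt_op_intertwine[OF P(2) P(2) AR(2)])+
  have DE: "D * E = E * D" "D' * E = E * D'"
    by (simp_all add: E_def left_diff_distrib right_diff_distrib AD)
  have DD: "D * D = 1 - ?c * C" "D' * D' = 1 - C * ?c"
    unfolding assms(8,9) by (rule sqrt_op_square[OF P(1)] sqrt_op_square[OF P(2)])+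
  \<comment> \<open>With \<open>?c * C = 1 - D * D\<close>, \<open>?N\<close> is an expression in
    the commuting operators \<open>D\<close> and \<open>E\<close>, so \<open>D\<close> commutes with
    \<open>?N\<close> and hence with \<open>B\<close>; similarly for the primed operators.\<close>
  have N_D: "?N = D * D + E * E * (1 - D * D)" "?N' = D' * D' + E * E * (1 - D' * D')"
    unfolding N DD by (simp_all add: mult.assoc)
  have DN: "D * ?N = ?N * D" "D' * ?N' = ?N' * D'"
    unfolding N_D by (simp_all add: distrib_left distrib_right left_diff_distrib right_diff_distrib
        mult.assoc DE DE[THEN mult_eq_assoc])
  have DB: "D * B = B * D" "D' * B' = B' * D'"
    unfolding assms(6,7) by (rule inv_sqrt_op_intertwine[OF B B DN(1)] inv_sqrt_op_intertwine[OF B' B' DN(2)])+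
  \<comment> \<open>Since \<open>C * (?c * C) = (C * ?c) * C\<close>, \<open>C\<close> intertwines
    \<open>?N\<close> with \<open>?N'\<close> and, below, the two defects; both relations pass to
    the roots.\<close>
  have "C * ?N = ?N' * C"
    unfolding N by (simp add: distrib_left distrib_right left_diff_distrib right_diff_distrib mult.assoc
        EC EC[THEN mult_eq_assoc])
  then have CB: "C * B = B' * C"
    unfolding assms(6,7) by (rule inv_sqrt_op_intertwine[OF B B'])
  have CD: "C * D = D' * C"
    unfolding assms(8,9) by (rule sqrt_op_intertwine[OF P])
      (simp add: left_diff_distrib right_diff_distrib mult.assoc)
  have "B * B * ?N = 1" "B' * B' * ?N' = 1"
    unfolding assms(6,7) by (rule inv_sqrt_op_square[OF B] inv_sqrt_op_square[OF B'])+
  then have BN: "B * B * (D * D + E * E * ?c * C) = 1" "B' * B' * (D' * D' + E * E * C * ?c) = 1"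
    unfolding N DD .
  have adj_BD: "adj B = B" "adj B' = B'" "adj D = D" "adj D' = D'"
    using adj_inv_sqrt_op[OF B] adj_inv_sqrt_op[OF B'] P
    by (simp_all only: assms(6-9) positive_op_selfadjoint positive_op_sqrt_op)
  interpret dilation_data A B B' C D D' E
    by unfold_locales (fact adj_A adj_BD assms(1) AB AD DB[symmetric] CB CD DD BN E_def)+
  have U_eq: "block dilation i j = M i j" for i j
  proof (rule bop_eqI)
    fix x
    show "block dilation i j x = M i j x"
      unfolding assms(11) E_def[symmetric]
      by (auto simp: block.rep_eq coord_dilation emb.rep_eq)
  qed
  then have U: "U = dilation"
    unfolding assms(12) by (rule op_of_blocks_eqI)
  have S: "S n = A ^ (n - 1) * (B * D * C) ^ n" if n: "n \<ge> 1" for n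
  proof -
    let ?R = "inv_op (sqrt_op A)" and ?G = "B * D * C"
    have AG: "A * ?G = ?G * A"
      by (simp add: mult.assoc A_commutes A_commutes[THEN mult_eq_assoc])
    have RA: "A * ?R = ?R * A"
      by (rule inv_sqrt_op_intertwine) (simp_all add: assms(2,3))
    have RG: "?G * ?R = ?R * ?G"
      by (rule inv_sqrt_op_intertwine) (simp_all add: assms(2,3) AG)
    have T: "T = A * ?G"
      by (simp add: assms(10) mult.assoc)
    obtain m where m: "n = Suc m"
      using n by (cases n) auto
    \<comment> \<open>The outer factors can thus be brought together; \<open>?R * ?R\<close> is the
      inverse of \<open>A\<close> and cancels one of the n factors \<open>A\<close> in
      \<open>T ^ n\<close>.\<close>
    have "T * ?R = ?R * T"
      unfolding T by (metis RA RG mult.assoc)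
    then have "T ^ n * ?R = ?R * T ^ n"
      by (rule power_commuting_commutes)
    then have "S n = ?R * ?R * T ^ n"
      using m by (simp add: assms(13) mult.assoc del: power_Suc)
    also have "\<dots> = (?R * ?R * A) * (A ^ m * ?G ^ n)"
      unfolding T power_mult_distrib_commuting[OF AG] by (simp add: m mult.assoc)
    finally show ?thesis
      using inv_sqrt_op_square[OF assms(2,3)] by (simp add: m del: power_Suc)
  qed
  have "orth_proj (range (emb 0)) ((U ^ n) (emb 0 x)) = emb 0 (S n x)" for n x
  \<comment> \<open>The case n = 0 is separate: \<open>S 0\<close> is 1 by definition, whereas the
    general formula would give the inverse of \<open>A\<close>.\<close>
  proof (cases n)
    case 0
    then show ?thesis
      by (simp add: orth_proj_emb emb.rep_eq assms(13))
  next
    case (Suc m)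
    then show ?thesis
      using S[of n] coord_dilation_power_Suc[of m x] by (simp add: orth_proj_emb U del: power_Suc)
  qed
  then show ?thesis
    unfolding unitary_dilation_def using U U_eq S unitary_dilation_op by blast
qed

end
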